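(* Let $\mathcal{X}$ be a metric space with its Borel $\sigma$-algebra, and let $(\mathcal{X},\mathcal{A},L)$ be a basic game. Let $\Gamma\subseteq\mathcal{P}$ be a nonempty, convex, weakly closed and tight set of distributions. Suppose that for each $a\in\mathcal{A}$ the loss function $L(x,a)$ is bounded above and upper semicontinuous in $x$. Then the restricted game $\mathcal{G}^\Gamma=(\Gamma,\mathcal{A},L)$ has a value, that is, its lower value $\sup_{P\in\Gamma}\inf_{\zeta\in\mathcal{Z}}L(P,\zeta)$ and its upper value $\inf_{\zeta\in\mathcal{Z}}\sup_{P\in\Gamma}L(P,\zeta)$ are equal and finite. Moreover, a maximum entropy distribution $P^*\in\Gamma$, attaining $$\sup_{P\in\Gamma}\inf_{a\in\mathcal{A}}L(P,a),$$ exists.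
   Context: A basic game $(\mathcal{X},\mathcal{A},L)$ consists of a sample space $\mathcal{X}$ and an action space $\mathcal{A}$, each equipped with a $\sigma$-field containing all singletons, and a jointly measurable loss function $L:\mathcal{X}\times\mathcal{A}\to(-\infty,\infty]$. Expectations are taken in the extended sense $E f=E f^+-E f^-$, defined (possibly as $\pm\infty$) unless both terms are infinite. $L(P,a):=E_P\{L(X,a)\}$, and $\mathcal{P}$ is the set of all probability distributions $P$ on $\mathcal{X}$ such that $L(P,a)$ is defined for all $a\in\mathcal{A}$. For a randomized act $\zeta$ (a probability distribution on $\mathcal{A}$), $L(P,\zeta):=E_{(X,A)\sim P\times\zeta}\{L(X,A)\}$, and $\mathcal{Z}$ is the set of all $\zeta$ such that $L(P,\zeta)$ is defined for all $P\in\mathcal{P}$. The generalized entropy of $P\in\mathcal{P}$ is $H(P):=\inf_{a\in\mathcal{A}}L(P,a)$, which also equals $\inf_{\zeta\in\mathcal{Z}}L(P,\zeta)$. In the restricted game $\mathcal{G}^\Gamma=(\Gamma,\mathcal{A},L)$, Nature selects $P\in\Gamma$, the Decision Maker selects an act (possibly randomized, $\zeta\in\mathcal{Z}$), and the loss to the Decision Maker is $L(P,\zeta)$. A family $\Gamma$ of distributions on $\mathcal{X}$ is tight if for all $\varepsilon>0$ there is a compact set $C$ with $P(C)>1-\varepsilon$ for all $P\in\Gamma$. "Weakly" refers to the topology of weak convergence of probability measures.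
   Formalization: Finiteness of the value is claimed only if some P in Γ has entropy H(P) ≠ −∞ (one-point X, A = ℕ, L(x,a) = −a has both values −∞); equality of the lower and upper values, value < ∞, and existence of a maximum entropy distribution are proved without this proviso. *)

theory Defs
  imports "HOL-Probability.Probability"
begin

text \<open>Only the underlying sets and sigma-fields of the measures \<open>X\<close> (sample space) and \<open>A\<close> (action
  space) are used.  Both spaces are nonempty, as speaking of outcomes and acts presupposes.\<close>

definition basic_game :: "'x measure \<Rightarrow> 'a measure \<Rightarrow> ('x \<Rightarrow> 'a \<Rightarrow> ereal) \<Rightarrow> bool" where
  "basic_game X A L \<longleftrightarrow>
     space X \<noteq> {} \<and> space A \<noteq> {} \<and>
     (\<forall>x\<in>space X. {x} \<in> sets X) \<and>
     (\<forall>a\<in>space A. {a} \<in> sets A) \<and>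
     (\<lambda>(x, a). L x a) \<in> borel_measurable (X \<Otimes>\<^sub>M A) \<and>
     (\<forall>x\<in>space X. \<forall>a\<in>space A. L x a \<noteq> -\<infinity>)"

text \<open>Since \<open>e2ennreal\<close> sends negative numbers to \<open>0\<close>, the two functions below are \<open>E f\<^sup>+\<close> and
  \<open>E f\<^sup>-\<close>.\<close>

definition expect_pos :: "'b measure \<Rightarrow> ('b \<Rightarrow> ereal) \<Rightarrow> ennreal" where
  "expect_pos M f = (\<integral>\<^sup>+ x. e2ennreal (f x) \<partial>M)"

definition expect_neg :: "'b measure \<Rightarrow> ('b \<Rightarrow> ereal) \<Rightarrow> ennreal" where
  "expect_neg M f = (\<integral>\<^sup>+ x. e2ennreal (- f x) \<partial>M)"

definition expect_defined :: "'b measure \<Rightarrow> ('b \<Rightarrow> ereal) \<Rightarrow> bool" where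
  "expect_defined M f \<longleftrightarrow> \<not> (expect_pos M f = \<infinity> \<and> expect_neg M f = \<infinity>)"

definition expect :: "'b measure \<Rightarrow> ('b \<Rightarrow> ereal) \<Rightarrow> ereal" where
  "expect M f = enn2ereal (expect_pos M f) - enn2ereal (expect_neg M f)"

text \<open>\<open>space (prob_algebra M)\<close> is the set of all probability measures on the measurable space \<open>M\<close>.\<close>

definition dists :: "'x measure \<Rightarrow> 'a measure \<Rightarrow> ('x \<Rightarrow> 'a \<Rightarrow> ereal) \<Rightarrow> 'x measure set" where
  "dists X A L =
     {P \<in> space (prob_algebra X). \<forall>a\<in>space A. expect_defined P (\<lambda>x. L x a)}"

definition loss :: "('x \<Rightarrow> 'a \<Rightarrow> ereal) \<Rightarrow> 'x measure \<Rightarrow> 'a \<Rightarrow> ereal" where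
  "loss L P a = expect P (\<lambda>x. L x a)"

definition rand_acts :: "'x measure \<Rightarrow> 'a measure \<Rightarrow> ('x \<Rightarrow> 'a \<Rightarrow> ereal) \<Rightarrow> 'a measure set" where
  "rand_acts X A L =
     {\<zeta> \<in> space (prob_algebra A).
        \<forall>P\<in>dists X A L. expect_defined (P \<Otimes>\<^sub>M \<zeta>) (\<lambda>(x, a). L x a)}"

definition rand_loss :: "('x \<Rightarrow> 'a \<Rightarrow> ereal) \<Rightarrow> 'x measure \<Rightarrow> 'a measure \<Rightarrow> ereal" where
  "rand_loss L P \<zeta> = expect (P \<Otimes>\<^sub>M \<zeta>) (\<lambda>(x, a). L x a)"

definition gen_entropy :: "'a measure \<Rightarrow> ('x \<Rightarrow> 'a \<Rightarrow> ereal) \<Rightarrow> 'x measure \<Rightarrow> ereal" where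
  "gen_entropy A L P = (INF a\<in>space A. loss L P a)"

definition lower_value ::
    "'x measure \<Rightarrow> 'a measure \<Rightarrow> ('x \<Rightarrow> 'a \<Rightarrow> ereal) \<Rightarrow> 'x measure set \<Rightarrow> ereal" where
  "lower_value X A L \<Gamma> = (SUP P\<in>\<Gamma>. INF \<zeta>\<in>rand_acts X A L. rand_loss L P \<zeta>)"

definition upper_value ::
    "'x measure \<Rightarrow> 'a measure \<Rightarrow> ('x \<Rightarrow> 'a \<Rightarrow> ereal) \<Rightarrow> 'x measure set \<Rightarrow> ereal" where
  "upper_value X A L \<Gamma> = (INF \<zeta>\<in>rand_acts X A L. SUP P\<in>\<Gamma>. rand_loss L P \<zeta>)"

text \<open>Finiteness is a genuine condition even for very regular games.  On a one-point sample space,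
  with the natural numbers as action space and \<open>L x a = - a\<close>, every loss function is bounded above
  and continuous, but both values are \<open>-\<infinity>\<close>.\<close>

definition has_value ::
    "'x measure \<Rightarrow> 'a measure \<Rightarrow> ('x \<Rightarrow> 'a \<Rightarrow> ereal) \<Rightarrow> 'x measure set \<Rightarrow> bool" where
  "has_value X A L \<Gamma> \<longleftrightarrow>
     lower_value X A L \<Gamma> = upper_value X A L \<Gamma> \<and> \<bar>upper_value X A L \<Gamma>\<bar> \<noteq> \<infinity>"

definition max_entropy_dist ::
    "'a measure \<Rightarrow> ('x \<Rightarrow> 'a \<Rightarrow> ereal) \<Rightarrow> 'x measure set \<Rightarrow> 'x measure \<Rightarrow> bool" where
  "max_entropy_dist A L \<Gamma> P \<longleftrightarrow>
     P \<in> \<Gamma> \<and> gen_entropy A L P = (SUP Q\<in>\<Gamma>. gen_entropy A L Q)"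

definition mixture :: "real \<Rightarrow> 'x measure \<Rightarrow> 'x measure \<Rightarrow> 'x measure" where
  "mixture t P Q =
     measure_of (space P) (sets P) (\<lambda>E. ennreal t * emeasure P E + ennreal (1 - t) * emeasure Q E)"

definition convex_dists :: "'x measure set \<Rightarrow> bool" where
  "convex_dists \<Gamma> \<longleftrightarrow> (\<forall>P\<in>\<Gamma>. \<forall>Q\<in>\<Gamma>. \<forall>t\<in>{0..1}. mixture t P Q \<in> \<Gamma>)"

text \<open>The topology of weak convergence on the Borel probability measures: the coarsest topology for
  which \<open>P \<mapsto> \<integral>f dP\<close> is continuous for every bounded continuous real function \<open>f\<close>.  The
  function space \<open>('x \<Rightarrow>\<^sub>C real) \<Rightarrow> real\<close> carries the product topology.\<close>

definition weak_topology :: "'x::metric_space measure topology" where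
  "weak_topology =
     pullback_topology (space (prob_algebra borel))
       (\<lambda>P (f :: 'x \<Rightarrow>\<^sub>C real). \<integral>x. apply_bcontfun f x \<partial>P) euclidean"

definition tight_dists :: "'x::metric_space measure set \<Rightarrow> bool" where
  "tight_dists \<Gamma> \<longleftrightarrow> (\<forall>\<epsilon>>0. \<exists>C. compact C \<and> (\<forall>P\<in>\<Gamma>. measure P C > 1 - \<epsilon>))"

definition upper_semicontinuous :: "('x::topological_space \<Rightarrow> ereal) \<Rightarrow> bool" where
  "upper_semicontinuous f \<longleftrightarrow> (\<forall>x. Limsup (at x) f \<le> f x)"

end

theory Submission
  imports Defs
begin

text \<open>Since \<open>L(\<cdot>, a)\<close> is bounded above and upper semicontinuous, \<open>P \<mapsto> L(P, a)\<close> is an upper semicontinuous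
  affine function: \<open>b - L(\<cdot>, a)\<close> is an increasing limit of bounded continuous functions. A tight, weakly
  closed \<open>\<Gamma>\<close> is weakly compact: a limit of the functionals \<open>f \<mapsto> \<integral>f dP\<close>, which exists by Tychonoff's theorem, is a
  positive functional that inherits the tightness estimates, and these make it continuous along
  monotone sequences, hence an integral.

  Let \<open>U\<close> be the upper value. If the closed sets \<open>{P \<in> \<Gamma>. L(P, a) \<ge> c}\<close> with \<open>c < U\<close> had no common point, then by
  compactness finitely many acts would already keep \<open>min L(P, a)\<close> below some \<open>c < U\<close> on \<open>\<Gamma>\<close>. Separation of
  convex sets then yields a mixture of these acts whose loss stays below \<open>U\<close> on all of \<open>\<Gamma>\<close>, which is
  absurd. A common point has entropy at least \<open>U\<close>, and entropy never exceeds the lower value.\<close>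

subsection \<open>Bounded continuous functions\<close>

lemma bcontfunI:
  assumes "continuous_on UNIV f" "\<And>x. \<bar>f x\<bar> \<le> (B::real)"
  shows "f \<in> bcontfun"
  using assms by (auto simp: bcontfun_def bounded_iff)

text \<open>The approximants are the infimal convolutions (Pasch--Hausdorff envelopes) of the truncations of
  \<open>g\<close> with \<open>n * dist\<close>.\<close>

lemma lsc_eq_SUP_bcontfun:
  fixes g :: "'x::metric_space \<Rightarrow> ennreal"
  assumes lsc: "\<And>x c. c < g x \<Longrightarrow> eventually (\<lambda>y. c < g y) (at x)"
  obtains u :: "nat \<Rightarrow> 'x \<Rightarrow> real" where "\<And>n. u n \<in> bcontfun" "\<And>n x. 0 \<le> u n x"
    "\<And>x. incseq (\<lambda>n. u n x)" "\<And>x. (SUP n. ennreal (u n x)) = g x"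
proof -
  \<comment> \<open>Truncation at height \<open>n\<close> makes the values finite, so
    \<open>enn2real\<close> loses nothing, and it also bounds \<open>u n\<close>.\<close>
  define h where "h n y = enn2real (min (of_nat n) (g y))" for n y
  define u where "u n x = (INF y. h n y + n * dist x y)" for n x
  have h_eq: "ennreal (h n y) = min (of_nat n) (g y)" for n y
    unfolding h_def by (rule ennreal_enn2real) (auto simp: min_def less_top[symmetric])
  have h_bounds: "0 \<le> h n y" "h n y \<le> n" for n y
  proof -
    show "0 \<le> h n y" by (simp add: h_def)
    have "ennreal (h n y) \<le> ennreal (real n)" unfolding h_eq by (simp add: ennreal_of_nat_eq_real_of_nat)
    then show "h n y \<le> n" by simp
  qed
  have h_mono: "h m y \<le> h n y" if "m \<le> n" for m n y
  proof -
    have "ennreal (h m y) \<le> ennreal (h n y)" unfolding h_eq by (rule min.mono) (use that in auto)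
    then show ?thesis using h_bounds by (simp add: ennreal_le_iff)
  qed
  have bdd: "bdd_below (range (\<lambda>y. h n y + n * dist x y))" for n x
    using h_bounds by (intro bdd_belowI[of _ 0]) auto
  have u_le: "u n x \<le> h n y + n * dist x y" for n x y
    unfolding u_def by (rule cINF_lower[OF bdd]) simp
  have u_ge: "c \<le> u n x" if "\<And>y. c \<le> h n y + n * dist x y" for c n x
    unfolding u_def by (rule cINF_greatest) (use that in auto)
  have u_nonneg: "0 \<le> u n x" for n x by (rule u_ge) (use h_bounds in auto)
  have u_le_h: "u n x \<le> h n x" for n x using u_le[of n x x] by simp
  have u_lipschitz: "u n x \<le> u n y + n * dist x y" for n x y
  proof -
    have "u n x - n * dist x y \<le> u n y"
    proof (rule u_ge)
      fix z
      have "n * dist x z \<le> n * (dist x y + dist y z)" by (intro mult_left_mono dist_triangle) auto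
      then show "u n x - n * dist x y \<le> h n z + n * dist y z"
        using u_le[of n x z] by (simp add: algebra_simps)
    qed
    then show ?thesis by simp
  qed
  have cont: "continuous_on UNIV (u n)" for n
  proof (rule lipschitz_on_continuous_on)
    show "(real n)-lipschitz_on UNIV (u n)"
    proof (rule lipschitz_onI)
      fix x y
      show "dist (u n x) (u n y) \<le> real n * dist x y"
        using u_lipschitz[of n x y] u_lipschitz[of n y x] by (simp add: dist_real_def dist_commute abs_le_iff)
    qed simp
  qed
  show thesis
  proof (rule that[of u])
    show "u n \<in> bcontfun" for n
    proof (rule bcontfunI[OF cont])
      show "\<bar>u n x\<bar> \<le> real n" for x
        using u_nonneg[of n x] u_le_h[of n x] h_bounds(2)[of n x] by linarith
    qed
    show "0 \<le> u n x" for n x by (rule u_nonneg)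
    show "incseq (\<lambda>n. u n x)" for x
    proof (rule monoI, rule u_ge)
      fix m n y assume "m \<le> (n::nat)"
      then show "u m x \<le> h n y + n * dist x y"
        using u_le[of m x y] h_mono[of m n y] mult_right_mono[of "real m" "real n" "dist x y"] by force
    qed
    show "(SUP n. ennreal (u n x)) = g x" for x
    proof (rule antisym)
      show "(SUP n. ennreal (u n x)) \<le> g x"
      proof (rule SUP_least)
        fix n
        have "ennreal (u n x) \<le> ennreal (h n x)" by (rule ennreal_leI[OF u_le_h])
        then show "ennreal (u n x) \<le> g x" unfolding h_eq by simp
      qed
      show "g x \<le> (SUP n. ennreal (u n x))"
      proof (rule dense_le)
        fix c assume c: "c < g x"
        then obtain r where r: "c = ennreal r" "0 \<le> r" by (cases c) auto
        obtain \<delta> where \<delta>: "\<delta> > 0" "\<And>y. dist y x < \<delta> \<Longrightarrow> c < g y"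
          using lsc[OF c] c by (auto simp: eventually_at) metis
        \<comment> \<open>For \<open>y\<close> within \<delta> of \<open>x\<close>,
          \<open>r \<le> n\<close> keeps the truncation from cutting \<open>g y\<close> below
          \<open>r\<close>; for all other \<open>y\<close>, \<open>r / \<delta> \<le> n\<close>
          makes the distance penalty alone reach \<open>r\<close>.\<close>
        obtain n :: nat where n: "r \<le> n" "r / \<delta> \<le> n"
          by (meson max.cobounded1 max.cobounded2 order_trans real_arch_simple)
        have "r \<le> u n x"
        proof (rule u_ge)
          fix y
          show "r \<le> h n y + n * dist x y"
          proof (cases "dist y x < \<delta>")
            case True
            have "ennreal r \<le> of_nat n" using n r by (simp add: ennreal_of_nat_eq_real_of_nat ennreal_leI)
            then have "ennreal r \<le> ennreal (h n y)" unfolding h_eq using \<delta>(2)[OF True] r by auto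
            then have "r \<le> h n y" using h_bounds by (simp add: ennreal_le_iff)
            moreover have "0 \<le> n * dist x y" by simp
            ultimately show ?thesis by linarith
          next
            case False
            have "r \<le> n * \<delta>" using n \<delta> by (simp add: field_simps)
            also have "\<dots> \<le> n * dist x y" using False by (intro mult_left_mono) (auto simp: dist_commute)
            finally show ?thesis using h_bounds(1)[of n y] by linarith
          qed
        qed
        then show "c \<le> (SUP n. ennreal (u n x))"
          unfolding r(1) by (intro SUP_upper2[of n]) (auto intro: ennreal_leI)
      qed
    qed
  qed
qed

section \<open>Closure properties and integrability of bounded continuous functions\<close>

lemma bcontfun_bound:
  assumes "f \<in> bcontfun" shows "\<exists>B::real. \<forall>x. \<bar>f x\<bar> \<le> B"
  using assms by (auto simp: bcontfun_def bounded_iff)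

lemma bcontfun_continuous: "f \<in> bcontfun \<Longrightarrow> continuous_on UNIV f"
  by (simp add: bcontfun_def)

lemma bcontfun_add [simp]:
  fixes f g :: "'x::topological_space \<Rightarrow> real"
  assumes f: "f \<in> bcontfun" and g: "g \<in> bcontfun" shows "(\<lambda>x. f x + g x) \<in> bcontfun"
proof -
  obtain B where B: "\<And>x. \<bar>f x\<bar> \<le> B" using bcontfun_bound[OF f] by blast
  obtain C where C: "\<And>x. \<bar>g x\<bar> \<le> C" using bcontfun_bound[OF g] by blast
  have "\<bar>f x + g x\<bar> \<le> B + C" for x using B C by (meson abs_triangle_ineq add_mono order_trans)
  then show ?thesis by (intro bcontfunI[of _ "B + C"] continuous_intros bcontfun_continuous[OF f] bcontfun_continuous[OF g])
qed

lemma bcontfun_cmult [simp]: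
  fixes f :: "'x::topological_space \<Rightarrow> real"
  assumes f: "f \<in> bcontfun" shows "(\<lambda>x. c * f x) \<in> bcontfun"
proof -
  obtain B where "\<And>x. \<bar>f x\<bar> \<le> B" using bcontfun_bound[OF f] by blast
  then have "\<bar>c * f x\<bar> \<le> \<bar>c\<bar> * B" for x by (auto simp: abs_mult intro: mult_left_mono)
  then show ?thesis by (intro bcontfunI[of _ "\<bar>c\<bar> * B"] continuous_intros bcontfun_continuous[OF f])
qed

lemma bcontfun_max [simp]:
  fixes f g :: "'x::topological_space \<Rightarrow> real"
  assumes f: "f \<in> bcontfun" and g: "g \<in> bcontfun" shows "(\<lambda>x. max (f x) (g x)) \<in> bcontfun"
proof -
  obtain B where B: "\<And>x. \<bar>f x\<bar> \<le> B" using bcontfun_bound[OF f] by blast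
  obtain C where C: "\<And>x. \<bar>g x\<bar> \<le> C" using bcontfun_bound[OF g] by blast
  have "\<bar>max (f x) (g x)\<bar> \<le> max B C" for x using B[of x] C[of x] by (auto simp: max_def)
  then show ?thesis by (intro bcontfunI[of _ "max B C"] continuous_intros bcontfun_continuous[OF f] bcontfun_continuous[OF g])
qed

declare const_bcontfun [simp]

lemma bcontfun_diff [simp]:
  fixes f g :: "'x::topological_space \<Rightarrow> real"
  shows "f \<in> bcontfun \<Longrightarrow> g \<in> bcontfun \<Longrightarrow> (\<lambda>x. f x - g x) \<in> bcontfun"
  using bcontfun_add[of f "\<lambda>x. - 1 * g x"] bcontfun_cmult[of g "- 1"] by simp

lemma bcontfun_min [simp]:
  fixes f g :: "'x::topological_space \<Rightarrow> real"
  assumes "f \<in> bcontfun" "g \<in> bcontfun" shows "(\<lambda>x. min (f x) (g x)) \<in> bcontfun"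
proof -
  have "(\<lambda>x. min (f x) (g x)) = (\<lambda>x. f x + g x - max (f x) (g x))" by (auto simp: min_def max_def)
  then show ?thesis using assms by simp
qed

lemma bcontfun_sum [simp]:
  fixes f :: "'i \<Rightarrow> 'x::topological_space \<Rightarrow> real"
  assumes "\<And>i. i \<in> I \<Longrightarrow> f i \<in> bcontfun" shows "(\<lambda>x. \<Sum>i\<in>I. f i x) \<in> bcontfun"
  using assms by (induction I rule: infinite_finite_induct) auto

lemma integrable_bcontfun:
  assumes f: "(f :: 'x::metric_space \<Rightarrow> real) \<in> bcontfun" and P: "finite_measure P" "sets P = sets borel"
  shows "integrable P f"
proof -
  interpret finite_measure P by fact
  obtain B where B: "\<And>x. \<bar>f x\<bar> \<le> B" using bcontfun_bound[OF f] by blast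
  have "f \<in> borel_measurable borel" by (intro borel_measurable_continuous_onI bcontfun_continuous f)
  then have "f \<in> borel_measurable P" using P(2) by (simp cong: measurable_cong_sets)
  then show ?thesis by (intro integrable_const_bound[of _ B]) (use B in auto)
qed

subsection \<open>Tight positive functionals are integrals\<close>

text \<open>These properties survive pointwise limits of expectation functionals: they are built
  from non-strict relations between finitely many values of \<open>l\<close>. Tightness is expressed
  through test functions vanishing on a compact set, since \<open>l\<close> does not evaluate
  sets.\<close>

locale tight_functional =
  fixes l :: "('x::metric_space \<Rightarrow> real) \<Rightarrow> real"
  assumes l_add: "f \<in> bcontfun \<Longrightarrow> g \<in> bcontfun \<Longrightarrow> l (\<lambda>x. f x + g x) = l f + l g"
    and l_cmult: "f \<in> bcontfun \<Longrightarrow> l (\<lambda>x. c * f x) = c * l f"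
    and l_nonneg: "f \<in> bcontfun \<Longrightarrow> (\<And>x. 0 \<le> f x) \<Longrightarrow> 0 \<le> l f"
    and l_one: "l (\<lambda>_. 1) = 1"
    and l_tight: "0 < e \<Longrightarrow> \<exists>C. compact C \<and>
      (\<forall>f\<in>bcontfun. (\<forall>x. 0 \<le> f x \<and> f x \<le> 1) \<longrightarrow> (\<forall>x\<in>C. f x = 0) \<longrightarrow> l f \<le> e)"
begin

lemma l_const: "l (\<lambda>_. c) = c"
  using l_cmult[of "\<lambda>_. 1" c] by (simp add: l_one)

lemma l_diff: "f \<in> bcontfun \<Longrightarrow> g \<in> bcontfun \<Longrightarrow> l (\<lambda>x. f x - g x) = l f - l g"
  using l_add[of f "\<lambda>x. - 1 * g x"] bcontfun_cmult[of g "- 1"] l_cmult[of g "- 1"] by simp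

lemma l_mono: "f \<in> bcontfun \<Longrightarrow> g \<in> bcontfun \<Longrightarrow> (\<And>x. f x \<le> g x) \<Longrightarrow> l f \<le> l g"
  using l_nonneg[of "\<lambda>x. g x - f x"] l_diff[of g f] by simp

lemma l_sum:
  assumes "\<And>i. i \<in> I \<Longrightarrow> f i \<in> bcontfun" shows "l (\<lambda>x. \<Sum>i\<in>I. f i x) = (\<Sum>i\<in>I. l (f i))"
  using assms by (induction I rule: infinite_finite_induct) (auto simp: l_const l_add)

text \<open>Dini's argument: finitely many of the open sets where \<open>g n < e\<close> cover the
  compact set from \<open>l_tight\<close>, so \<open>g n < e\<close> holds on all of it for late
  \<open>n\<close>. The excess \<open>max 0 (g n - e)\<close> then vanishes there, and
  \<open>l_tight\<close> bounds its value.\<close>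

lemma l_decseq_tendsto:
  assumes g: "\<And>n. g n \<in> bcontfun" "\<And>n x. 0 \<le> g n x" "\<And>n x. g n x \<le> 1"
    and dec: "\<And>x. decseq (\<lambda>n. g n x)" and lim: "\<And>x. (\<lambda>n. g n x) \<longlonglongrightarrow> 0"
  shows "(\<lambda>n. l (g n)) \<longlonglongrightarrow> 0"
proof (rule LIMSEQ_I)
  fix r :: real assume "0 < r"
  define e where "e = r / 3"
  have e: "0 < e" using \<open>0 < r\<close> by (simp add: e_def)
  from l_tight[OF e] obtain C where "compact C \<and>
    (\<forall>f\<in>bcontfun. (\<forall>x. 0 \<le> f x \<and> f x \<le> 1) \<longrightarrow> (\<forall>x\<in>C. f x = 0) \<longrightarrow> l f \<le> e)" ..
  then have C: "compact C" "\<And>f. f \<in> bcontfun \<Longrightarrow> (\<And>x. 0 \<le> f x \<and> f x \<le> 1) \<Longrightarrow> (\<And>x. x \<in> C \<Longrightarrow> f x = 0) \<Longrightarrow> l f \<le> e"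
    by simp_all
  have "open {x. g n x < e}" for n
    using g(1) by (intro open_Collect_less continuous_intros bcontfun_continuous)
  moreover have "C \<subseteq> (\<Union>n. {x. g n x < e})"
  proof
    fix x assume "x \<in> C"
    have "eventually (\<lambda>n. g n x < e) sequentially" using lim[of x] e by (rule order_tendstoD)
    then show "x \<in> (\<Union>n. {x. g n x < e})" by (auto simp: eventually_sequentially)
  qed
  ultimately obtain D where D: "finite D" "C \<subseteq> (\<Union>n\<in>D. {x. g n x < e})"
    by (rule compactE_image[OF C(1)])
  obtain N where N: "\<And>n. n \<in> D \<Longrightarrow> n \<le> N" using D(1) finite_nat_set_iff_bounded_le by auto
  have small: "g n x < e" if "n \<ge> N" "x \<in> C" for n x
  proof -
    obtain m where "m \<in> D" "g m x < e" using D(2) \<open>x \<in> C\<close> by blast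
    then show ?thesis using N[of m] that decseqD[OF dec, of m n x] by linarith
  qed
  have "norm (l (g n) - 0) < r" if "N \<le> n" for n
  proof -
    have "l (\<lambda>x. max 0 (g n x - e)) \<le> e"
    proof (rule C(2))
      fix x
      show "0 \<le> max 0 (g n x - e) \<and> max 0 (g n x - e) \<le> 1" using g(3)[of n x] e by auto
      show "max 0 (g n x - e) = 0" if "x \<in> C" using small[OF \<open>N \<le> n\<close> that] by simp
    qed (simp add: g)
    moreover have "l (g n) \<le> l (\<lambda>x. e + max 0 (g n x - e))" by (rule l_mono) (auto simp: g)
    ultimately have "l (g n) \<le> 2 * e" by (simp add: l_add l_const g)
    then show ?thesis using l_nonneg[OF g(1,2)] e by (auto simp: e_def)
  qed
  then show "\<exists>N. \<forall>n\<ge>N. norm (l (g n) - 0) < r" by blast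
qed

text \<open>Daniell's construction: a function \<open>g - f\<close> with \<open>f \<le> g\<close> is represented by the half-open strip between
  the graphs. Strips form a semiring of subsets of \<open>UNIV \<times> {0..<1}\<close>, and the functional applied to the
  fibre lengths is a premeasure on it. A set \<open>E\<close> corresponds to \<open>E \<times> {0..<1}\<close>, which is how the measure
  obtained from Caratheodory's theorem is brought back to the base space.\<close>

definition strip :: "('x \<Rightarrow> real) \<Rightarrow> ('x \<Rightarrow> real) \<Rightarrow> ('x \<times> real) set"
  where "strip f g = {(x, t). f x \<le> t \<and> t < g x}"

text \<open>Where \<open>g\<close> drops below \<open>f\<close> the fibre is empty, so pairs built
  with \<open>max\<close> and \<open>min\<close> stay in the family without a case split.\<close>

definition strips :: "('x \<times> real) set set"
  where "strips = {strip f g | f g. f \<in> bcontfun \<and> g \<in> bcontfun \<and> (\<forall>x. 0 \<le> f x) \<and> (\<forall>x. g x \<le> 1)}"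

definition slab :: "('x \<times> real) set"
  where "slab = UNIV \<times> {0..<1}"

text \<open>Measuring the fibre, instead of taking \<open>g - f\<close>, makes the quantity depend
  on the set only and not on the functions representing it.\<close>

definition fibre_length :: "('x \<times> real) set \<Rightarrow> 'x \<Rightarrow> real"
  where "fibre_length S x = measure lborel {t. (x, t) \<in> S}"

lemma stripsI: "f \<in> bcontfun \<Longrightarrow> g \<in> bcontfun \<Longrightarrow> (\<And>x. 0 \<le> f x) \<Longrightarrow> (\<And>x. g x \<le> 1) \<Longrightarrow> strip f g \<in> strips"
  unfolding strips_def by blast

lemma stripsE:
  assumes "S \<in> strips"
  obtains f g where "S = strip f g" "f \<in> bcontfun" "g \<in> bcontfun" "\<And>x. 0 \<le> f x" "\<And>x. g x \<le> 1"
  using assms unfolding strips_def by blast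

lemma fibre_strip: "{t. (x, t) \<in> strip f g} = {f x..<g x}"
  by (auto simp: strip_def)

lemma fibre_length_strip: "fibre_length (strip f g) x = max 0 (g x - f x)"
  unfolding fibre_length_def fibre_strip by (cases "f x \<le> g x") auto

lemma fibre_length_bcontfun: "S \<in> strips \<Longrightarrow> fibre_length S \<in> bcontfun"
  by (erule stripsE) (simp add: fibre_length_strip[abs_def])

lemma fibre_length_le_1: "S \<in> strips \<Longrightarrow> fibre_length S x \<le> 1"
proof (erule stripsE)
  fix f g assume S: "S = strip f g" and "\<And>x. 0 \<le> f x" "\<And>x. g x \<le> 1"
  then have "0 \<le> f x" "g x \<le> 1" by blast+
  then show ?thesis by (simp add: S fibre_length_strip)
qed

lemma fibre_length_nonneg: "0 \<le> fibre_length S x"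
  by (simp add: fibre_length_def)

lemma semiring_strips: "semiring_of_sets slab strips"
proof
  have sub: "strip f g \<subseteq> slab" if "\<And>x. 0 \<le> f x" "\<And>x. g x \<le> 1" for f g
  proof clarify
    fix x t assume "(x, t) \<in> strip f g"
    then show "(x, t) \<in> slab" using that(1)[of x] that(2)[of x] by (simp add: strip_def slab_def)
  qed
  then show "strips \<subseteq> Pow slab" by (auto elim!: stripsE)
  have "strip (\<lambda>_. 0) (\<lambda>_. 0) \<in> strips" by (rule stripsI) auto
  moreover have "strip (\<lambda>_. 0) (\<lambda>_. 0) = {}" by (auto simp: strip_def)
  ultimately show "{} \<in> strips" by metis
next
  fix a b assume a: "a \<in> strips" and b: "b \<in> strips"
  obtain f g where fg: "a = strip f g" "f \<in> bcontfun" "g \<in> bcontfun" "\<And>x. 0 \<le> f x" "\<And>x. g x \<le> 1"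
    using stripsE[OF a] by blast
  obtain f' g' where fg': "b = strip f' g'" "f' \<in> bcontfun" "g' \<in> bcontfun" "\<And>x. 0 \<le> f' x" "\<And>x. g' x \<le> 1"
    using stripsE[OF b] by blast
  have "a \<inter> b = strip (\<lambda>x. max (f x) (f' x)) (\<lambda>x. min (g x) (g' x))"
    by (auto simp: fg fg' strip_def)
  also have "\<dots> \<in> strips"
    by (rule stripsI) (use fg fg' in \<open>auto simp: le_max_iff_disj min_le_iff_disj\<close>)
  finally show "a \<inter> b \<in> strips" .
  \<comment> \<open>\<open>?c\<close> is the part of \<open>a\<close> below \<open>b\<close> and
    \<open>?d\<close> the part above. The term \<open>f'\<close> in the lower bound of
    \<open>?d\<close> keeps the two disjoint where \<open>g' < f'\<close>, that is, where the fibre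
    of \<open>b\<close> is empty.\<close>
  let ?c = "strip f (\<lambda>x. min (g x) (f' x))" and ?d = "strip (\<lambda>x. max (f x) (max (f' x) (g' x))) g"
  have "?c \<in> strips" "?d \<in> strips"
    by (rule stripsI; use fg fg' in \<open>auto simp: le_max_iff_disj min_le_iff_disj\<close>)+
  moreover have "?c \<inter> ?d = {}" "a - b = ?c \<union> ?d"
    by (auto simp: fg fg' strip_def)
  ultimately show "\<exists>C\<subseteq>strips. finite C \<and> disjoint C \<and> a - b = \<Union>C"
    by (intro exI[of _ "{?c, ?d}"]) (auto simp: disjoint_def)
qed

text \<open>Countable additivity of Lebesgue measure on each fibre makes the remainders of the fibre
  lengths decrease to zero pointwise; \<open>l_decseq_tendsto\<close> carries this over to
  \<open>l\<close>.\<close>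

lemma countably_additive_strips: "countably_additive strips (\<lambda>S. ennreal (l (fibre_length S)))"
proof (rule countably_additiveI)
  fix A :: "nat \<Rightarrow> ('x \<times> real) set"
  assume A: "range A \<subseteq> strips" and disj: "disjoint_family A" and U: "(\<Union>i. A i) \<in> strips"
  have Ai: "A i \<in> strips" for i using A by blast
  let ?L = fibre_length and ?U = "\<Union>i. A i"
  have meas: "{t. (x, t) \<in> S} \<in> sets lborel" "emeasure lborel {t. (x, t) \<in> S} \<noteq> \<infinity>" if "S \<in> strips" for x S
  proof -
    obtain f g where "S = strip f g" using \<open>S \<in> strips\<close> by (rule stripsE)
    then show "{t. (x, t) \<in> S} \<in> sets lborel" "emeasure lborel {t. (x, t) \<in> S} \<noteq> \<infinity>"
      by (cases "f x \<le> g x"; simp add: fibre_strip)+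
  qed
  have sums: "(\<lambda>i. ?L (A i) x) sums ?L ?U x" for x
  proof -
    have eq: "{t. (x, t) \<in> ?U} = (\<Union>i. {t. (x, t) \<in> A i})" by auto
    show ?thesis
      unfolding fibre_length_def eq
    proof (rule measure_UNION)
      show "range (\<lambda>i. {t. (x, t) \<in> A i}) \<subseteq> sets lborel" using meas(1)[OF Ai] by blast
      show "disjoint_family (\<lambda>i. {t. (x, t) \<in> A i})" using disj by (fastforce simp: disjoint_family_on_def)
      show "emeasure lborel (\<Union>i. {t. (x, t) \<in> A i}) \<noteq> \<infinity>" using meas(2)[OF U, of x] unfolding eq .
    qed
  qed
  \<comment> \<open>Since the union is itself a strip, its fibre length is continuous, and so is
    every remainder.\<close>
  define r where "r n x = ?L ?U x - (\<Sum>i<n. ?L (A i) x)" for n x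
  have "(\<lambda>n. l (r n)) \<longlonglongrightarrow> 0"
  proof (rule l_decseq_tendsto)
    show "r n \<in> bcontfun" for n
      unfolding r_def[abs_def] using fibre_length_bcontfun Ai U by (intro bcontfun_diff bcontfun_sum) auto
    have "(\<Sum>i<n. ?L (A i) x) \<le> ?L ?U x" for n x
      using sums[of x] sum_le_suminf[of "\<lambda>i. ?L (A i) x" "{..<n}"]
      by (auto simp: fibre_length_nonneg sums_iff)
    then show "0 \<le> r n x" for n x by (simp add: r_def)
    have "0 \<le> (\<Sum>i<n. ?L (A i) x)" for n x by (intro sum_nonneg fibre_length_nonneg)
    then have "r n x \<le> ?L ?U x" for n x by (simp add: r_def)
    then show "r n x \<le> 1" for n x using fibre_length_le_1[OF U, of x] by (rule order_trans)
    show "decseq (\<lambda>n. r n x)" for x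
      by (rule decseq_SucI) (simp add: r_def fibre_length_nonneg)
    show "(\<lambda>n. r n x) \<longlonglongrightarrow> 0" for x
      unfolding r_def using tendsto_diff[OF tendsto_const sums[of x, unfolded sums_def], of "?L ?U x"] by simp
  qed
  moreover have "l (r n) = l (?L ?U) - (\<Sum>i<n. l (?L (A i)))" for n
    unfolding r_def[abs_def] using fibre_length_bcontfun Ai U by (simp add: l_diff l_sum)
  ultimately have "(\<lambda>n. l (?L ?U) - (l (?L ?U) - (\<Sum>i<n. l (?L (A i))))) \<longlonglongrightarrow> l (?L ?U) - 0"
    by (intro tendsto_diff tendsto_const) simp
  then have "(\<lambda>i. l (?L (A i))) sums l (?L ?U)" by (simp add: sums_def)
  then show "(\<Sum>i. ennreal (l (?L (A i)))) = ennreal (l (?L ?U))"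
    by (intro suminf_ennreal_eq l_nonneg fibre_length_bcontfun Ai fibre_length_nonneg)
qed

section \<open>The measure on the slab and its image on the base space\<close>

lemma strip_measure_exists:
  obtains N where "space N = slab" "\<And>S. S \<in> strips \<Longrightarrow> S \<in> sets N"
    "\<And>S. S \<in> strips \<Longrightarrow> emeasure N S = ennreal (l (fibre_length S))"
proof -
  interpret semiring_of_sets slab strips by (rule semiring_strips)
  have "positive strips (\<lambda>S. ennreal (l (fibre_length S)))"
    by (simp add: positive_def fibre_length_def[abs_def] l_const)
  then obtain \<nu> where \<nu>: "\<And>S. S \<in> strips \<Longrightarrow> \<nu> S = ennreal (l (fibre_length S))"
    "measure_space slab (sigma_sets slab strips) \<nu>"
    using caratheodory[OF _ countably_additive_strips] by blast
  let ?N = "measure_of slab (sigma_sets slab strips) \<nu>"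
  have sub: "sigma_sets slab strips \<subseteq> Pow slab" by (rule sigma_sets_into_sp[THEN PowI, THEN subsetI]) (use space_closed in auto)
  have sets: "sets ?N = sigma_sets slab strips"
    by (simp add: sets_measure_of[OF sub] sigma_sets_sigma_sets_eq[OF space_closed])
  show thesis
  proof (rule that[of ?N])
    show "space ?N = slab" by (rule space_measure_of[OF sub])
    fix S assume S: "S \<in> strips"
    show "S \<in> sets ?N" unfolding sets using S by (rule sigma_sets.Basic)
    then show "emeasure ?N S = ennreal (l (fibre_length S))"
      using \<nu> S unfolding sets measure_space_def
      by (subst emeasure_measure_of_sigma) auto
  qed
qed

text \<open>The indicator of an open set is lower semicontinuous, hence an increasing limit of
  functions \<open>u n\<close>. A number strictly below a supremum lies below some
  \<open>u n x\<close>, so the strips under the \<open>u n\<close> fill the cylinder over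
  \<open>U\<close> exactly. This yields measurability of the projection.\<close>

lemma slab_over_open:
  assumes "open U"
  obtains u :: "nat \<Rightarrow> 'x \<Rightarrow> real"
  where "\<And>n. strip (\<lambda>_. 0) (u n) \<in> strips" "(\<Union>n. strip (\<lambda>_. 0) (u n)) = U \<times> {0..<1}"
proof -
  have lsc: "eventually (\<lambda>y. c < indicator U y) (at x)" if "c < indicator U x" for x and c :: ennreal
  proof -
    have "x \<in> U" using that by (cases "x \<in> U") auto
    then have "eventually (\<lambda>y. y \<in> U) (at x)" using \<open>open U\<close> by (rule eventually_at_in_open'[rotated])
    then show ?thesis using that \<open>x \<in> U\<close> by (auto elim: eventually_mono)
  qed
  obtain u where u: "\<And>n. u n \<in> bcontfun" "\<And>n x. 0 \<le> u n x"
    "\<And>x. incseq (\<lambda>n. u n x)" "\<And>x. (SUP n. ennreal (u n x)) = indicator U x"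
    using lsc_eq_SUP_bcontfun[of "indicator U", OF lsc] by blast
  have le: "ennreal (u n x) \<le> indicator U x" for n x
    unfolding u(4)[symmetric] by (rule SUP_upper) simp
  have u_le_1: "u n x \<le> 1" for n x
  proof -
    have "ennreal (u n x) \<le> 1" using le[of n x] by (cases "x \<in> U") auto
    then show ?thesis by simp
  qed
  have "(\<exists>n. t < u n x) \<longleftrightarrow> x \<in> U \<and> t < 1" if "0 \<le> t" for x t
  proof -
    have "(\<exists>n. t < u n x) \<longleftrightarrow> (\<exists>n. ennreal t < ennreal (u n x))"
      using that by (simp add: ennreal_less_iff)
    also have "\<dots> \<longleftrightarrow> ennreal t < indicator U x"
      unfolding u(4)[symmetric] by (simp add: less_SUP_iff)
    also have "\<dots> \<longleftrightarrow> x \<in> U \<and> t < 1"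
      using that by (auto simp: indicator_def ennreal_less_iff simp flip: ennreal_1)
    finally show ?thesis .
  qed
  then have "(x, t) \<in> (\<Union>n. strip (\<lambda>_. 0) (u n)) \<longleftrightarrow> (x, t) \<in> U \<times> {0..<1}" for x t
    by (cases "0 \<le> t") (simp_all add: strip_def)
  then have "(\<Union>n. strip (\<lambda>_. 0) (u n)) = U \<times> {0..<1}" by (auto simp only: set_eq_iff)
  moreover have "strip (\<lambda>_. 0) (u n) \<in> strips" for n
    by (rule stripsI) (use u(1) u_le_1 in auto)
  ultimately show thesis using that[of u] by blast
qed

text \<open>\<open>P\<close> is the image of the strip measure under the projection. The region
  under \<open>h\<close> has measure \<open>l h\<close> and lies in the cylinder over
  \<open>E\<close>, so monotonicity gives the bound.\<close>

lemma dominated_by_measure: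
  obtains P where "prob_space P" "sets P = sets borel"
    "\<And>h E. h \<in> bcontfun \<Longrightarrow> (\<And>x. 0 \<le> h x) \<Longrightarrow> (\<And>x. h x \<le> 1) \<Longrightarrow> E \<in> sets borel \<Longrightarrow>
      (\<And>x. x \<notin> E \<Longrightarrow> h x = 0) \<Longrightarrow> l h \<le> measure P E"
proof -
  obtain N where N: "space N = slab" "\<And>S. S \<in> strips \<Longrightarrow> S \<in> sets N"
    "\<And>S. S \<in> strips \<Longrightarrow> emeasure N S = ennreal (l (fibre_length S))"
    using strip_measure_exists by blast
  have fst: "fst \<in> borel_measurable N"
  proof (rule borel_measurableI)
    fix U :: "'x set" assume "open U"
    obtain u where u: "\<And>n. strip (\<lambda>_. 0) (u n) \<in> strips" "(\<Union>n::nat. strip (\<lambda>_. 0) (u n)) = U \<times> {0..<1}"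
      using slab_over_open[OF \<open>open U\<close>] by blast
    have "fst -` U \<inter> space N = (\<Union>n. strip (\<lambda>_. 0) (u n))"
      unfolding u N slab_def by auto
    then show "fst -` U \<inter> space N \<in> sets N" using N(2) u(1) by auto
  qed
  define P where "P = distr N borel fst"
  have vimage: "fst -` E \<inter> space N = E \<times> {0..<1}" for E :: "'x set"
    unfolding N slab_def by auto
  have strip01: "strip (\<lambda>_. 0) (\<lambda>_. 1) = slab" by (auto simp: strip_def slab_def)
  have "strip (\<lambda>_. 0) (\<lambda>_. 1) \<in> strips" by (rule stripsI) auto
  from N(3)[OF this] have "emeasure N slab = 1"
    by (simp add: strip01[symmetric] fibre_length_strip[abs_def] l_one)
  then have "prob_space P"
    unfolding P_def using fst N(1) by (intro prob_space.prob_space_distr prob_spaceI) auto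
  interpret P: prob_space P by fact
  show thesis
  proof (rule that[of P])
    fix h :: "'x \<Rightarrow> real" and E assume h: "h \<in> bcontfun" "\<And>x. 0 \<le> h x" "\<And>x. h x \<le> 1" and E: "E \<in> sets borel"
      and out: "\<And>x. x \<notin> E \<Longrightarrow> h x = 0"
    have strip: "strip (\<lambda>_. 0) h \<in> strips" using h by (auto intro: stripsI)
    have sub: "strip (\<lambda>_. 0) h \<subseteq> fst -` E \<inter> space N"
    proof clarify
      fix x t assume "(x, t) \<in> strip (\<lambda>_. 0) h"
      then show "(x, t) \<in> fst -` E \<inter> space N"
        using out[of x] h(3)[of x] unfolding vimage by (force simp: strip_def)
    qed
    have "ennreal (l h) = ennreal (l (fibre_length (strip (\<lambda>_. 0) h)))"
      using h(2) by (simp add: fibre_length_strip[abs_def] max_absorb2)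
    also have "\<dots> = emeasure N (strip (\<lambda>_. 0) h)" using N(3)[OF strip] by simp
    also have "\<dots> \<le> emeasure N (fst -` E \<inter> space N)"
      by (rule emeasure_mono[OF sub]) (use measurable_sets[OF fst E] in simp)
    also have "\<dots> = emeasure P E" unfolding P_def using fst E by (simp add: emeasure_distr)
    finally show "l h \<le> measure P E" by (simp add: P.emeasure_eq_measure ennreal_le_iff)
  qed (use \<open>prob_space P\<close> in \<open>simp_all add: P_def\<close>)
qed

text \<open>Slicing \<open>f\<close> at the levels \<open>k/n\<close>: the functional of each slice is at most \<open>P {f > k/n} / n\<close>, and
  this is at most the integral of the slice below.\<close>

lemma representing_measure:
  obtains P where "prob_space P" "sets P = sets borel"
    "\<And>f. f \<in> bcontfun \<Longrightarrow> l f = (\<integral>x. f x \<partial>P)"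
proof -
  obtain P where P: "prob_space P" "sets P = sets borel"
    and dom: "\<And>h E. h \<in> bcontfun \<Longrightarrow> (\<And>x. 0 \<le> h x) \<Longrightarrow> (\<And>x. h x \<le> 1) \<Longrightarrow> E \<in> sets borel \<Longrightarrow>
      (\<And>x. x \<notin> E \<Longrightarrow> h x = 0) \<Longrightarrow> l h \<le> measure P E"
    by (rule dominated_by_measure) metis
  interpret P: prob_space P by fact
  note integrable = integrable_bcontfun[OF _ P.finite_measure_axioms P(2)]
  have le: "l f \<le> (\<integral>x. f x \<partial>P)" if f: "f \<in> bcontfun" "\<And>x. 0 \<le> f x" "\<And>x. f x \<le> 1" for f
  proof (rule field_le_epsilon)
    fix e :: real assume "0 < e"
    then obtain m :: nat where m: "1 / real (Suc m) < e" using nat_approx_posE by blast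
    define n where "n = real (Suc m)"
    have n: "0 < n" by (simp add: n_def)
    define s where "s k x = min (real k / n) (f x)" for k x
    define E where "E k = {x. real k / n < f x}" for k
    have s_bc: "s k \<in> bcontfun" for k unfolding s_def[abs_def] using f by simp
    have E: "E k \<in> sets borel" for k
      unfolding E_def using f(1) by (intro borel_open open_Collect_less continuous_intros bcontfun_continuous)
    have l_slice: "l (\<lambda>x. s (Suc k) x - s k x) \<le> measure P (E k) / n" for k
    proof -
      have "l (\<lambda>x. n * (s (Suc k) x - s k x)) \<le> measure P (E k)"
      proof (rule dom[OF _ _ _ E])
        fix x
        have "real (Suc k) / n = real k / n + 1 / n" "0 < 1 / n"
          using n by (simp_all add: add_divide_distrib)
        then have "s k x \<le> s (Suc k) x" "s (Suc k) x \<le> s k x + 1 / n"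
          unfolding s_def by linarith+
        then show "0 \<le> n * (s (Suc k) x - s k x)" "n * (s (Suc k) x - s k x) \<le> 1"
          using n by (auto simp: field_simps)
        show "n * (s (Suc k) x - s k x) = 0" if "x \<notin> E k"
        proof -
          have "f x \<le> real k / n" using that by (simp add: E_def)
          moreover have "real k / n \<le> real (Suc k) / n" using n by (intro divide_right_mono) auto
          ultimately show ?thesis by (simp add: s_def min_absorb2)
        qed
      qed (use s_bc in simp)
      moreover have "l (\<lambda>x. n * (s (Suc k) x - s k x)) = n * l (\<lambda>x. s (Suc k) x - s k x)"
        by (rule l_cmult) (use s_bc in simp)
      ultimately show ?thesis using n by (simp add: pos_le_divide_eq mult.commute)
    qed
    \<comment> \<open>On \<open>E (Suc k)\<close> the slice between \<open>k/n\<close> and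
      \<open>(k+1)/n\<close> has its full height \<open>1/n\<close>.\<close>
    have int_slice: "measure P (E (Suc k)) / n \<le> (\<integral>x. s (Suc k) x - s k x \<partial>P)" for k
    proof -
      have "measure P (E (Suc k)) / n = (\<integral>x. indicator (E (Suc k)) x / n \<partial>P)"
        using E[of "Suc k"] P(2) by simp
      also have "\<dots> \<le> (\<integral>x. s (Suc k) x - s k x \<partial>P)"
      proof (rule integral_mono)
        show "integrable P (\<lambda>x. indicator (E (Suc k)) x / n :: real)"
          using E[of "Suc k"] P(2)
          by (intro integrable_divide integrable_real_indicator) (simp_all add: P.emeasure_eq_measure)
        show "integrable P (\<lambda>x. s (Suc k) x - s k x)" using s_bc integrable by simp
        show "indicator (E (Suc k)) x / n \<le> s (Suc k) x - s k x" for x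
          using n by (auto simp: indicator_def E_def s_def min_def add_divide_distrib)
      qed
      finally show ?thesis .
    qed
    have f_eq: "f x = (\<Sum>k<Suc m. s (Suc k) x - s k x)" for x
      unfolding sum_lessThan_telescope[of "\<lambda>k. s k x"] using f(2,3)[of x] n by (simp add: s_def n_def min_def)
    then have "f = (\<lambda>x. \<Sum>k<Suc m. s (Suc k) x - s k x)" by (rule ext)
    then have "l f = l (\<lambda>x. \<Sum>k<Suc m. s (Suc k) x - s k x)" by (rule arg_cong)
    also have "\<dots> = (\<Sum>k<Suc m. l (\<lambda>x. s (Suc k) x - s k x))"
      by (rule l_sum) (use s_bc in simp)
    also have "\<dots> \<le> (\<Sum>k<Suc m. measure P (E k) / n)" by (intro sum_mono l_slice)
    \<comment> \<open>Splitting off the term for \<open>E 0\<close>, which costs at most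
      \<open>1/n\<close>, pairs the bound for slice \<open>k + 1\<close> with the integral of slice
      \<open>k\<close>.\<close>
    also have "\<dots> = measure P (E 0) / n + (\<Sum>k<m. measure P (E (Suc k)) / n)"
      by (simp add: sum.lessThan_Suc_shift del: sum.lessThan_Suc)
    also have "\<dots> \<le> 1 / n + (\<Sum>k<m. \<integral>x. s (Suc k) x - s k x \<partial>P)"
      using n by (intro add_mono divide_right_mono sum_mono int_slice) auto
    also have "(\<Sum>k<m. \<integral>x. s (Suc k) x - s k x \<partial>P) = (\<integral>x. s m x - s 0 x \<partial>P)"
      using s_bc integrable by (subst Bochner_Integration.integral_sum[symmetric]) (auto simp: sum_lessThan_telescope[of "\<lambda>k. s k x" for x])
    also have "\<dots> \<le> (\<integral>x. f x \<partial>P)"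
      using s_bc f integrable by (intro integral_mono) (auto simp: s_def)
    finally show "l f \<le> (\<integral>x. f x \<partial>P) + e" using m by (simp add: n_def)
  qed
  \<comment> \<open>The reverse inequality is \<open>le\<close> applied to
    \<open>1 - f\<close>.\<close>
  have eq: "l f = (\<integral>x. f x \<partial>P)" if f: "f \<in> bcontfun" "\<And>x. 0 \<le> f x" "\<And>x. f x \<le> 1" for f
  proof (rule antisym)
    have "l (\<lambda>x. 1 - f x) \<le> (\<integral>x. 1 - f x \<partial>P)" by (rule le) (use f in auto)
    then show "(\<integral>x. f x \<partial>P) \<le> l f"
      using f integrable[OF f(1)] by (simp add: l_diff l_const P.prob_space)
  qed (rule le[OF f])
  have "l f = (\<integral>x. f x \<partial>P)" if f: "f \<in> bcontfun" for f
  proof -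
    obtain B where "\<And>x. \<bar>f x\<bar> \<le> B" using bcontfun_bound[OF f] by blast
    then have B: "- (\<bar>B\<bar> + 1) \<le> f x" "f x \<le> \<bar>B\<bar> + 1" for x
      by (smt (verit))+
    \<comment> \<open>This scale puts \<open>1/2 + c * f\<close> between 0 and 1, so that the case
      already settled applies.\<close>
    define c where "c = 1 / (2 * (\<bar>B\<bar> + 1))"
    have c: "0 < c" by (simp add: c_def)
    let ?g = "\<lambda>x. 1 / 2 + c * f x"
    have "l ?g = (\<integral>x. ?g x \<partial>P)"
    proof (rule eq)
      show "?g \<in> bcontfun" using f by simp
      show "0 \<le> ?g x" "?g x \<le> 1" for x using B[of x] by (auto simp: c_def field_simps)
    qed
    then show ?thesis using f integrable[OF f] c by (simp add: l_add l_cmult l_const P.prob_space)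
  qed
  then show thesis using that[OF P] by blast
qed

end

subsection \<open>Compactness\<close>

lemma Bcontfun_apply [simp]: "f \<in> bcontfun \<Longrightarrow> apply_bcontfun (Bcontfun f) = f"
  by (rule Bcontfun_inverse)

lemma prob_algebraD:
  assumes "P \<in> space (prob_algebra M)" shows "prob_space P" "sets P = sets M"
  using assms by (auto simp: space_prob_algebra)

text \<open>The weak topology is pulled back along this map, so compactness is shown for the image.
  The image sits in a product of intervals, compact by Tychonoff; tightness makes it closed by
  excluding limits that no probability measure represents.\<close>

lemma compact_expectations:
  fixes \<Gamma> :: "'x::metric_space measure set"
  assumes \<Gamma>: "\<Gamma> \<subseteq> space (prob_algebra borel)" and closed: "closedin weak_topology \<Gamma>"
    and tight: "tight_dists \<Gamma>"
  shows "compact ((\<lambda>P (f :: 'x \<Rightarrow>\<^sub>C real). \<integral>x. apply_bcontfun f x \<partial>P) ` \<Gamma>)"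
proof -
  define \<Phi> where "\<Phi> = (\<lambda>P (f :: 'x \<Rightarrow>\<^sub>C real). \<integral>x. apply_bcontfun f x \<partial>P)"
  define K where "K = PiE UNIV (\<lambda>f :: 'x \<Rightarrow>\<^sub>C real. {- norm f..norm f})"
  have "compactin (product_topology (\<lambda>_. euclidean) UNIV) K"
    unfolding K_def by (simp add: compactin_PiE)
  then have "compact K" by (simp add: euclidean_product_topology)
  have prob: "prob_space P" "sets P = sets borel" if "P \<in> \<Gamma>" for P
    using prob_algebraD[of P borel] \<Gamma> that by auto
  have integrable: "integrable P f" if "P \<in> \<Gamma>" "f \<in> bcontfun" for P and f :: "'x \<Rightarrow> real"
    using integrable_bcontfun[OF that(2)] prob[OF that(1)] prob_space.finite_measure by blast
  have "\<Phi> ` \<Gamma> \<subseteq> K"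
  proof
    fix \<Lambda> assume "\<Lambda> \<in> \<Phi> ` \<Gamma>"
    then obtain P where P: "P \<in> \<Gamma>" "\<Lambda> = \<Phi> P" by auto
    interpret prob_space P by (rule prob[OF P(1)])
    have "\<Phi> P f \<in> {- norm f..norm f}" for f
    proof -
      have "norm (\<Phi> P f) \<le> (\<integral>x. norm (apply_bcontfun f x) \<partial>P)"
        unfolding \<Phi>_def by (rule integral_norm_bound)
      also have "\<dots> \<le> (\<integral>x. norm f \<partial>P)"
        using integrable[OF P(1), of "apply_bcontfun f"] apply_bcontfun[of f] norm_bounded[of f]
        by (intro integral_mono integrable_norm) auto
      finally show ?thesis by (auto simp: prob_space)
    qed
    then show "\<Lambda> \<in> K" unfolding P(2) K_def by auto
  qed
  have "closure (\<Phi> ` \<Gamma>) \<subseteq> \<Phi> ` \<Gamma>"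
  proof
    fix \<Lambda> assume \<Lambda>: "\<Lambda> \<in> closure (\<Phi> ` \<Gamma>)"
    \<comment> \<open>Any closed condition met by all \<open>\<Phi> P\<close> with \<open>P\<close>
      in \<Gamma> passes to the limit \<Lambda>. The axioms of \<open>tight_functional\<close> are
      checked in this way, through conditions on finitely many coordinates.\<close>
    have mem: "\<Lambda> \<in> Q" if "closed Q" "\<And>P. P \<in> \<Gamma> \<Longrightarrow> \<Phi> P \<in> Q" for Q
      using closure_minimal[of "\<Phi> ` \<Gamma>" Q] that \<Lambda> by blast
    define l where "l f = \<Lambda> (Bcontfun f)" for f
    note cont = continuous_on_product_coordinates
    interpret tight_functional l
    proof
      fix f g :: "'x \<Rightarrow> real" assume f: "f \<in> bcontfun" and g: "g \<in> bcontfun"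
      have "\<Lambda> \<in> {\<Lambda>. \<Lambda> (Bcontfun (\<lambda>x. f x + g x)) = \<Lambda> (Bcontfun f) + \<Lambda> (Bcontfun g)}"
        by (rule mem, intro closed_Collect_eq continuous_on_add cont)
          (use f g integrable in \<open>simp add: \<Phi>_def\<close>)
      then show "l (\<lambda>x. f x + g x) = l f + l g" by (simp add: l_def)
    next
      fix f :: "'x \<Rightarrow> real" and c assume f: "f \<in> bcontfun"
      have "\<Lambda> \<in> {\<Lambda>. \<Lambda> (Bcontfun (\<lambda>x. c * f x)) = c * \<Lambda> (Bcontfun f)}"
        by (rule mem, intro closed_Collect_eq continuous_on_mult continuous_on_const cont)
          (use f in \<open>simp add: \<Phi>_def\<close>)
      then show "l (\<lambda>x. c * f x) = c * l f" by (simp add: l_def)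
    next
      fix f :: "'x \<Rightarrow> real" assume f: "f \<in> bcontfun" "\<And>x. 0 \<le> f x"
      have "\<Lambda> \<in> {\<Lambda>. 0 \<le> \<Lambda> (Bcontfun f)}"
        by (rule mem, intro closed_Collect_le continuous_on_const cont)
          (use f in \<open>simp add: \<Phi>_def\<close>)
      then show "0 \<le> l f" by (simp add: l_def)
    next
      have "\<Lambda> \<in> {\<Lambda>. \<Lambda> (Bcontfun (\<lambda>_. 1)) = 1}"
        by (rule mem, intro closed_Collect_eq continuous_on_const cont)
          (use prob_space.prob_space[OF prob(1)] in \<open>simp add: \<Phi>_def\<close>)
      then show "l (\<lambda>_. 1) = 1" by (simp add: l_def)
    next
      fix e :: real assume "0 < e"
      with tight have "\<exists>C. compact C \<and> (\<forall>P\<in>\<Gamma>. measure P C > 1 - e)"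
        unfolding tight_dists_def by simp
      then obtain C where "compact C \<and> (\<forall>P\<in>\<Gamma>. measure P C > 1 - e)" ..
      then have C: "compact C" "\<And>P. P \<in> \<Gamma> \<Longrightarrow> measure P C > 1 - e" by simp_all
      have "l f \<le> e" if f: "f \<in> bcontfun" "\<forall>x. 0 \<le> f x \<and> f x \<le> 1" "\<forall>x\<in>C. f x = 0" for f
      proof -
        have "\<Lambda> \<in> {\<Lambda>. \<Lambda> (Bcontfun f) \<le> e}"
        proof (rule mem)
          show "closed {\<Lambda>. \<Lambda> (Bcontfun f) \<le> e}" by (intro closed_Collect_le continuous_on_const cont)
          fix P assume P: "P \<in> \<Gamma>"
          interpret prob_space P by (rule prob[OF P])
          have Cs: "C \<in> sets P" using C(1) prob[OF P] by (simp add: borel_compact)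
          have "(\<integral>x. f x \<partial>P) \<le> (\<integral>x. indicator (space P - C) x \<partial>P)"
          proof (rule integral_mono)
            show "integrable P f" by (rule integrable[OF P f(1)])
            show "integrable P (indicator (space P - C) :: _ \<Rightarrow> real)"
              using Cs by (intro integrable_real_indicator) (auto simp: emeasure_eq_measure)
            show "f x \<le> indicator (space P - C) x" if "x \<in> space P" for x
              using f that by (cases "x \<in> C") auto
          qed
          also have "\<dots> = 1 - measure P C" using Cs by (simp add: prob_compl Int_absorb1)
          finally show "\<Phi> P \<in> {\<Lambda>. \<Lambda> (Bcontfun f) \<le> e}" using C(2)[OF P] f(1) by (simp add: \<Phi>_def)
        qed
        then show ?thesis by (simp add: l_def)
      qed
      then show "\<exists>C. compact C \<and>
        (\<forall>f\<in>bcontfun. (\<forall>x. 0 \<le> f x \<and> f x \<le> 1) \<longrightarrow> (\<forall>x\<in>C. f x = 0) \<longrightarrow> l f \<le> e)"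
        using C(1) by blast
    qed
    obtain P where P: "prob_space P" "sets P = sets borel" "\<And>f. f \<in> bcontfun \<Longrightarrow> l f = (\<integral>x. f x \<partial>P)"
      using representing_measure by blast
    have \<Phi>P: "\<Phi> P = \<Lambda>"
    proof
      fix f show "\<Phi> P f = \<Lambda> f"
        using P(3)[OF apply_bcontfun, of f] by (simp add: \<Phi>_def l_def apply_bcontfun_inverse)
    qed
    have P_prob: "P \<in> space (prob_algebra borel)" using P by (simp add: space_prob_algebra)
    \<comment> \<open>In the pullback topology, the complement of \<Gamma> is the preimage of an
      open \<open>U\<close>. An open set containing \<Lambda> would meet the image of \<Gamma>, so
      \<Lambda> is not in \<open>U\<close>.\<close>
    obtain U where U: "open U" "space (prob_algebra borel) - \<Gamma> = \<Phi> -` U \<inter> space (prob_algebra borel)"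
      using closed unfolding closedin_def weak_topology_def \<Phi>_def[symmetric]
      by (auto simp: openin_pullback_topology topspace_pullback_topology)
    have "U \<inter> \<Phi> ` \<Gamma> = {}" using U(2) \<Gamma> by auto
    then have "\<Lambda> \<notin> U" using open_Int_closure_eq_empty[OF U(1)] \<Lambda> by blast
    then have "P \<in> \<Gamma>" using U(2) P_prob \<Phi>P by auto
    then show "\<Lambda> \<in> \<Phi> ` \<Gamma>" using \<Phi>P by auto
  qed
  then have "closed (\<Phi> ` \<Gamma>)" by (simp add: closure_subset_eq)
  then have "compact (K \<inter> \<Phi> ` \<Gamma>)" by (rule compact_Int_closed[OF \<open>compact K\<close>])
  then show ?thesis using \<open>\<Phi> ` \<Gamma> \<subseteq> K\<close> unfolding \<Phi>_def by (simp only: Int_absorb1)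
qed

subsection \<open>Minimax for finitely many affine functions\<close>

text \<open>Separation in the plane: the convex set \<open>D\<close> of finite upper bounds for the
  pairs \<open>(f p, g p)\<close> misses the quadrant \<open>Q\<close> below \<open>(d, d)\<close>,
  and the normalised normal of a separating line gives the weights. The slack between
  \<open>e\<close> and \<open>d\<close> pays for making both weights positive.\<close>

lemma two_function_minimax:
  fixes f g :: "'p \<Rightarrow> ennreal" and mix :: "real \<Rightarrow> 'p \<Rightarrow> 'p \<Rightarrow> 'p" and d e :: real
  assumes mix: "\<And>t p q. t \<in> {0..1} \<Longrightarrow> p \<in> G \<Longrightarrow> q \<in> G \<Longrightarrow> mix t p q \<in> G"
    and f: "\<And>t p q. t \<in> {0..1} \<Longrightarrow> p \<in> G \<Longrightarrow> q \<in> G \<Longrightarrow>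
      f (mix t p q) = ennreal t * f p + ennreal (1 - t) * f q"
    and g: "\<And>t p q. t \<in> {0..1} \<Longrightarrow> p \<in> G \<Longrightarrow> q \<in> G \<Longrightarrow>
      g (mix t p q) = ennreal t * g p + ennreal (1 - t) * g q"
    and e: "0 \<le> e" "e < d"
    and max_ge: "\<And>p. p \<in> G \<Longrightarrow> f p \<ge> ennreal d \<or> g p \<ge> ennreal d"
  obtains t where "0 < t" "t < 1"
    "\<And>p. p \<in> G \<Longrightarrow> ennreal t * f p + ennreal (1 - t) * g p \<ge> ennreal e"
proof -
  define D where "D = {z :: real \<times> real. \<exists>p\<in>G. f p \<le> ennreal (fst z) \<and> g p \<le> ennreal (snd z) \<and> 0 \<le> fst z \<and> 0 \<le> snd z}"
  define Q where "Q = {..<d} \<times> {..<d}"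
  have inf_case: "ennreal t * f p + ennreal (1 - t) * g p \<ge> ennreal e"
    if "0 < t" "t < 1" "f p = \<infinity> \<or> g p = \<infinity>" for t p
    using that by (auto simp: ennreal_mult_top)
  show thesis
  proof (cases "D = {}")
    case True
    have "f p = \<infinity> \<or> g p = \<infinity>" if "p \<in> G" for p
    proof (rule ccontr)
      assume "\<not> ?thesis"
      then have "(enn2real (f p), enn2real (g p)) \<in> D"
        using that by (auto simp: D_def intro!: bexI[of _ p] simp: less_top)
      then show False using True by simp
    qed
    then show thesis using inf_case[of "1/2"] that[of "1/2"] by simp
  next
    case False
    have "convex D"
    proof (rule convexI)
      fix x y :: "real \<times> real" and u v :: real
      assume x: "x \<in> D" and y: "y \<in> D" and uv: "0 \<le> u" "0 \<le> v" "u + v = 1"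
      obtain p where p: "p \<in> G" "f p \<le> ennreal (fst x)" "g p \<le> ennreal (snd x)" "0 \<le> fst x" "0 \<le> snd x"
        using x by (auto simp: D_def)
      obtain q where q: "q \<in> G" "f q \<le> ennreal (fst y)" "g q \<le> ennreal (snd y)" "0 \<le> fst y" "0 \<le> snd y"
        using y by (auto simp: D_def)
      have v: "v = 1 - u" and u: "u \<in> {0..1}" using uv by auto
      have "f (mix u p q) \<le> ennreal u * ennreal (fst x) + ennreal v * ennreal (fst y)"
        unfolding f[OF u p(1) q(1)] v by (intro add_mono mult_left_mono p q) auto
      moreover have "g (mix u p q) \<le> ennreal u * ennreal (snd x) + ennreal v * ennreal (snd y)"
        unfolding g[OF u p(1) q(1)] v by (intro add_mono mult_left_mono p q) auto
      ultimately show "u *\<^sub>R x + v *\<^sub>R y \<in> D"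
        using mix[OF u p(1) q(1)] uv p q
        by (auto simp: D_def ennreal_mult[symmetric] ennreal_plus[symmetric] simp del: ennreal_plus
            intro!: bexI[of _ "mix u p q"])
    qed
    moreover have "convex Q" unfolding Q_def by (intro convex_Times convex_real_interval)
    moreover have "D \<inter> Q = {}"
    proof -
      have False if "z \<in> D" "z \<in> Q" for z
      proof -
        obtain p where p: "p \<in> G" "f p \<le> ennreal (fst z)" "g p \<le> ennreal (snd z)" "0 \<le> fst z" "0 \<le> snd z"
          using \<open>z \<in> D\<close> by (auto simp: D_def)
        have "ennreal d \<le> ennreal (fst z) \<or> ennreal d \<le> ennreal (snd z)"
          using max_ge[OF p(1)] p by (meson order_trans)
        then show False using p e \<open>z \<in> Q\<close> by (auto simp: Q_def ennreal_le_iff)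
      qed
      then show ?thesis by blast
    qed
    moreover have "(0, 0) \<in> Q" using e by (auto simp: Q_def)
    ultimately obtain w b where w: "w \<noteq> 0" "\<And>z. z \<in> Q \<Longrightarrow> inner w z \<le> b" "\<And>z. z \<in> D \<Longrightarrow> b \<le> inner w z"
      using separating_hyperplane_sets[of Q D] False by (metis Int_commute empty_iff)
    obtain w1 w2 where w12: "w = (w1, w2)" by (cases w)
    \<comment> \<open>\<open>Q\<close> is unbounded in both negative directions, so a negative
      coordinate of \<open>w\<close> would violate the bound on \<open>Q\<close>.\<close>
    have nonneg: "0 \<le> w1" "0 \<le> w2"
    proof -
      have neg: "\<not> c < 0" if "\<And>s. s \<ge> 0 \<Longrightarrow> - s * c \<le> b" for c
      proof
        assume "c < 0"
        then have "0 \<le> (\<bar>b\<bar> + 1) / - c" "- ((\<bar>b\<bar> + 1) / - c) * c = \<bar>b\<bar> + 1"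
          by (auto intro: divide_nonneg_neg)
        then show False using that[of "(\<bar>b\<bar> + 1) / - c"] by linarith
      qed
      have "- s * w1 \<le> b" "- s * w2 \<le> b" if "0 \<le> s" for s
        using w(2)[of "(- s, 0)"] w(2)[of "(0, - s)"] that e by (auto simp: Q_def w12 mult.commute)
      then show "0 \<le> w1" "0 \<le> w2" using neg[of w1] neg[of w2] by (meson not_less)+
    qed
    have pos: "0 < w1 + w2" using nonneg w(1) w12 by (auto simp: zero_prod_def)
    \<comment> \<open>The corner \<open>(d, d)\<close> lies outside \<open>Q\<close>, so it is
      approached along the diagonal.\<close>
    have bd: "(w1 + w2) * d \<le> b"
    proof (rule field_le_epsilon)
      fix r :: real assume "0 < r"
      have "inner w (d - r / (w1 + w2), d - r / (w1 + w2)) \<le> b"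
        by (rule w(2)) (use \<open>0 < r\<close> pos in \<open>auto simp: Q_def\<close>)
      then have "(w1 + w2) * (d - r / (w1 + w2)) \<le> b" by (simp add: w12 distrib_right)
      then show "(w1 + w2) * d \<le> b + r" using pos by (simp add: right_diff_distrib)
    qed
    define s where "s = w1 / (w1 + w2)"
    have s: "0 \<le> s" "s \<le> 1" using nonneg pos by (auto simp: s_def)
    have s': "1 - s = w2 / (w1 + w2)" using pos by (simp add: s_def field_simps)
    have D_ge: "d \<le> s * fst z + (1 - s) * snd z" if "z \<in> D" for z
    proof -
      have "(w1 + w2) * d \<le> w1 * fst z + w2 * snd z"
        using bd w(3)[OF that] by (cases z) (auto simp: w12)
      moreover have "s * fst z + (1 - s) * snd z = (w1 * fst z + w2 * snd z) / (w1 + w2)"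
        unfolding s' unfolding s_def by (simp add: add_divide_distrib)
      ultimately show ?thesis using pos by (simp add: pos_le_divide_eq mult.commute)
    qed
    \<comment> \<open>With this value \<open>(1 - \<delta>) * d = e\<close>, so scaling
      \<open>s\<close> by \<open>1 - \<delta>\<close> uses up exactly the slack.\<close>
    define \<delta> where "\<delta> = 1 - e / d"
    have \<delta>: "0 < \<delta>" "\<delta> \<le> 1" "(1 - \<delta>) * d = e" using e by (auto simp: \<delta>_def)
    \<comment> \<open>A weight strictly inside \<open>(0, 1)\<close> keeps infinite values of \<open>f\<close> and \<open>g\<close> effective, as \<open>0 * \<infinity> = 0\<close>.\<close>
    define t where "t = (1 - \<delta>) * s + \<delta> / 2"
    have t': "1 - t = (1 - \<delta>) * (1 - s) + \<delta> / 2" by (simp add: t_def field_simps)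
    have t: "0 < t" "0 < 1 - t"
      unfolding t' unfolding t_def using s \<delta> by (auto intro!: add_nonneg_pos mult_nonneg_nonneg)
    show thesis
    proof (rule that[of t])
      fix p assume p: "p \<in> G"
      show "ennreal e \<le> ennreal t * f p + ennreal (1 - t) * g p"
      proof (cases "f p = \<infinity> \<or> g p = \<infinity>")
        case True
        then show ?thesis using inf_case t by auto
      next
        case False
        define x y where "x = enn2real (f p)" and "y = enn2real (g p)"
        have fg: "f p = ennreal x" "g p = ennreal y" "0 \<le> x" "0 \<le> y"
          using False by (auto simp: x_def y_def less_top)
        have "(x, y) \<in> D" using p fg by (auto simp: D_def intro!: bexI[of _ p])
        then have "d \<le> s * x + (1 - s) * y" using D_ge by fastforce
        then have "(1 - \<delta>) * d \<le> (1 - \<delta>) * (s * x + (1 - s) * y)"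
          using \<delta> by (intro mult_left_mono) auto
        also have "\<dots> \<le> t * x + (1 - t) * y"
          unfolding t' unfolding t_def using fg \<delta> by (simp add: algebra_simps)
        finally show ?thesis
          using \<delta> fg t by (simp add: ennreal_mult[symmetric] ennreal_plus[symmetric] ennreal_leI del: ennreal_plus)
      qed
    qed (use t in auto)
  qed
qed

text \<open>Induction on \<open>S\<close>. On the part \<open>G'\<close> of \<open>G\<close> where
  \<open>f i\<close> is at most an intermediate level \<open>d'\<close>, one of the other functions
  always reaches \<open>d\<close>; \<open>G'\<close> is again closed under mixing, so some mixture
  of them is at least \<open>d'\<close> there. Off \<open>G'\<close>, \<open>f i\<close> exceeds
  \<open>d'\<close>. The two-function case combines \<open>f i\<close> with this mixture.\<close>

lemma finite_minimax:
  fixes f :: "'i \<Rightarrow> 'p \<Rightarrow> ennreal" and mix :: "real \<Rightarrow> 'p \<Rightarrow> 'p \<Rightarrow> 'p" and d e :: real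
  assumes "finite S" "S \<noteq> {}"
    and "\<And>t p q. t \<in> {0..1} \<Longrightarrow> p \<in> G \<Longrightarrow> q \<in> G \<Longrightarrow> mix t p q \<in> G"
    and "\<And>i t p q. i \<in> S \<Longrightarrow> t \<in> {0..1} \<Longrightarrow> p \<in> G \<Longrightarrow> q \<in> G \<Longrightarrow>
      f i (mix t p q) = ennreal t * f i p + ennreal (1 - t) * f i q"
    and "0 \<le> e" "e < d"
    and "\<And>p. p \<in> G \<Longrightarrow> \<exists>i\<in>S. f i p \<ge> ennreal d"
  shows "\<exists>w. (\<forall>i\<in>S. 0 \<le> w i) \<and> (\<Sum>i\<in>S. w i) = 1 \<and>
    (\<forall>p\<in>G. (\<Sum>i\<in>S. ennreal (w i) * f i p) \<ge> ennreal e)"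
  using assms
proof (induction S arbitrary: G d e rule: finite_ne_induct)
  case (singleton i)
  have "\<forall>p\<in>G. ennreal e \<le> f i p"
    using singleton.prems(4,5) by (auto intro: order_trans[OF ennreal_leI[of e d]])
  then show ?case by (intro exI[of _ "\<lambda>_. 1"]) auto
next
  case (insert i S)
  note mixG = insert.prems(1) and affine = insert.prems(2) and max_ge = insert.prems(5)
  obtain d' where d': "e < d'" "d' < d" using dense \<open>e < d\<close> by blast
  define G' where "G' = {p\<in>G. f i p \<le> ennreal d'}"
  have "\<exists>w. (\<forall>i\<in>S. 0 \<le> w i) \<and> (\<Sum>i\<in>S. w i) = 1 \<and>
    (\<forall>p\<in>G'. (\<Sum>i\<in>S. ennreal (w i) * f i p) \<ge> ennreal d')"
  proof (rule insert.IH)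
    fix t p q assume t: "t \<in> {0..1::real}" and p: "p \<in> G'" and q: "q \<in> G'"
    have "f i (mix t p q) = ennreal t * f i p + ennreal (1 - t) * f i q"
      using affine t p q by (auto simp: G'_def)
    also have "\<dots> \<le> ennreal t * ennreal d' + ennreal (1 - t) * ennreal d'"
      using p q by (intro add_mono mult_left_mono) (auto simp: G'_def)
    also have "\<dots> = ennreal d'"
      using t d' \<open>0 \<le> e\<close> by (simp add: ennreal_mult[symmetric] ennreal_plus[symmetric] algebra_simps del: ennreal_plus)
    finally show "mix t p q \<in> G'" using mixG t p q by (auto simp: G'_def)
  next
    fix p assume p: "p \<in> G'"
    have "\<not> ennreal d \<le> f i p"
    proof
      assume "ennreal d \<le> f i p"
      then have "ennreal d \<le> ennreal d'" using p by (auto simp: G'_def)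
      then show False using d' \<open>0 \<le> e\<close> by (simp add: ennreal_le_iff)
    qed
    then show "\<exists>j\<in>S. ennreal d \<le> f j p" using max_ge p by (auto simp: G'_def)
  qed (use d' \<open>0 \<le> e\<close> affine in \<open>auto simp: G'_def\<close>)
  then obtain w where w: "\<And>i. i \<in> S \<Longrightarrow> 0 \<le> w i" "(\<Sum>i\<in>S. w i) = 1"
    "\<And>p. p \<in> G' \<Longrightarrow> (\<Sum>i\<in>S. ennreal (w i) * f i p) \<ge> ennreal d'" by blast
  obtain t where t: "0 < t" "t < 1"
    "\<And>p. p \<in> G \<Longrightarrow> ennreal t * f i p + ennreal (1 - t) * (\<Sum>i\<in>S. ennreal (w i) * f i p) \<ge> ennreal e"
  proof (rule two_function_minimax[of G mix "f i" "\<lambda>p. \<Sum>i\<in>S. ennreal (w i) * f i p" e d'])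
    fix t p q assume t: "t \<in> {0..1::real}" "p \<in> G" "q \<in> G"
    show "(\<Sum>j\<in>S. ennreal (w j) * f j (mix t p q)) =
      ennreal t * (\<Sum>j\<in>S. ennreal (w j) * f j p) + ennreal (1 - t) * (\<Sum>j\<in>S. ennreal (w j) * f j q)"
      using affine[OF _ t] by (simp add: sum_distrib_left sum.distrib[symmetric] algebra_simps cong: sum.cong)
  next
    fix p assume p: "p \<in> G"
    show "ennreal d' \<le> f i p \<or> ennreal d' \<le> (\<Sum>j\<in>S. ennreal (w j) * f j p)"
      using w(3)[of p] p by (cases "p \<in> G'") (auto simp: G'_def)
  qed (use mixG affine d' \<open>0 \<le> e\<close> in auto)
  let ?w = "(\<lambda>j. (1 - t) * w j)(i := t)"
  have "\<forall>j\<in>insert i S. 0 \<le> ?w j" using t w by auto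
  moreover have "(\<Sum>j\<in>insert i S. ?w j) = 1"
  proof -
    have "(\<Sum>j\<in>S. ?w j) = (1 - t) * (\<Sum>j\<in>S. w j)"
      unfolding sum_distrib_left using insert.hyps by (intro sum.cong) auto
    then show ?thesis using insert.hyps w by simp
  qed
  moreover have "ennreal e \<le> (\<Sum>j\<in>insert i S. ennreal (?w j) * f j p)" if "p \<in> G" for p
  proof -
    have "(\<Sum>j\<in>S. ennreal (?w j) * f j p) = ennreal (1 - t) * (\<Sum>j\<in>S. ennreal (w j) * f j p)"
      unfolding sum_distrib_left using insert.hyps w t
      by (intro sum.cong) (auto simp: ennreal_mult mult.assoc)
    then show ?thesis using insert.hyps t(3)[OF that] by simp
  qed
  ultimately show ?case by (intro exI[of _ ?w]) blast
qed

subsection \<open>Expectations of losses\<close>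

lemma space_mixture [simp]: "space (mixture t P Q) = space P"
  by (simp add: mixture_def)

lemma sets_mixture [measurable_cong, simp]: "sets (mixture t P Q) = sets P"
  by (simp add: mixture_def)

lemma emeasure_mixture:
  assumes sets: "sets Q = sets P" and E: "E \<in> sets P"
  shows "emeasure (mixture t P Q) E = ennreal t * emeasure P E + ennreal (1 - t) * emeasure Q E"
proof (rule emeasure_measure_of[OF mixture_def])
  let ?\<mu> = "\<lambda>E. ennreal t * emeasure P E + ennreal (1 - t) * emeasure Q E"
  show "sets P \<subseteq> Pow (space P)" by (rule sets.space_closed)
  show "positive (sets (mixture t P Q)) ?\<mu>" by (simp add: positive_def)
  show "countably_additive (sets (mixture t P Q)) ?\<mu>"
  proof (rule countably_additiveI)
    fix F :: "nat \<Rightarrow> 'a set" assume F: "range F \<subseteq> sets (mixture t P Q)" "disjoint_family F"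
    then have P: "(\<Sum>i. emeasure P (F i)) = emeasure P (\<Union>i. F i)"
      and Q: "(\<Sum>i. emeasure Q (F i)) = emeasure Q (\<Union>i. F i)"
      using sets by (auto intro!: suminf_emeasure)
    show "(\<Sum>i. ?\<mu> (F i)) = ?\<mu> (\<Union>i. F i)"
      unfolding P[symmetric] Q[symmetric] by (simp add: suminf_add[symmetric])
  qed
qed (use E in simp)

text \<open>This shows the shifted loss to be affine in the distribution, as
  \<open>finite_minimax\<close> requires.\<close>

lemma nn_integral_mixture:
  assumes sets: "sets Q = sets P" and f: "f \<in> borel_measurable P"
  shows "(\<integral>\<^sup>+x. f x \<partial>mixture t P Q) = ennreal t * (\<integral>\<^sup>+x. f x \<partial>P) + ennreal (1 - t) * (\<integral>\<^sup>+x. f x \<partial>Q)"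
proof -
  have meas: "g \<in> borel_measurable P \<Longrightarrow> g \<in> borel_measurable Q"
    "g \<in> borel_measurable P \<Longrightarrow> g \<in> borel_measurable (mixture t P Q)" for g :: "'a \<Rightarrow> ennreal"
    using sets by (simp_all cong: measurable_cong_sets)
  have space: "space Q = space P" using sets by (rule sets_eq_imp_space_eq)
  show ?thesis
    using f
  proof (induction rule: borel_measurable_induct)
    case (cong f g)
    have "(\<integral>\<^sup>+x. f x \<partial>M) = (\<integral>\<^sup>+x. g x \<partial>M)" if "space M = space P" for M
      using cong(3) that by (intro nn_integral_cong) auto
    then show ?case using cong(4) space by simp
  next
    case (set E)
    then show ?case using sets by (simp add: emeasure_mixture)
  next
    case (mult u c)
    then show ?case by (simp add: nn_integral_cmult meas algebra_simps)
  next
    case (add u v)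
    then show ?case by (simp add: nn_integral_add meas algebra_simps)
  next
    case (seq U)
    have lim: "(\<integral>\<^sup>+x. (SUP i. U i x) \<partial>M) = (SUP i. \<integral>\<^sup>+x. U i x \<partial>M)"
      if "\<And>i. U i \<in> borel_measurable M" for M
      by (rule nn_integral_monotone_convergence_SUP[OF \<open>incseq U\<close> that])
    have inc: "incseq (\<lambda>i. c * (\<integral>\<^sup>+x. U i x \<partial>M))" for M and c :: ennreal
      using \<open>incseq U\<close> by (auto simp: mono_def le_fun_def intro!: mult_left_mono nn_integral_mono)
    show ?case
      using seq by (simp add: lim meas image_comp SUP_mult_left_ennreal ennreal_SUP_add[OF inc inc])
  qed
qed

section \<open>Expectations of functions bounded above, computed without subtraction\<close>

lemma e2ennreal_shift:
  assumes "y \<le> ereal b" "0 \<le> b"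
  shows "e2ennreal (ereal b - y) + e2ennreal y = ennreal b + e2ennreal (- y)"
proof (cases y)
  case (real r)
  then show ?thesis
    using assms
    by (cases "0 \<le> r") (simp_all add: e2ennreal_ereal ennreal_neg ennreal_plus[symmetric] del: ennreal_plus)
qed (use assms in \<open>auto simp: e2ennreal_neg\<close>)

text \<open>Integrates the pointwise identity \<open>(b - f) + f\<^sup>+ = b + f\<^sup>-\<close>,
  whose terms are all nonnegative. As the positive part has finite integral, the expectation reduces
  to the single nonnegative integral of \<open>b - f\<close>.\<close>

lemma expect_pos_neg_shift:
  assumes "prob_space M" and f: "f \<in> borel_measurable M"
    and b: "\<And>x. x \<in> space M \<Longrightarrow> f x \<le> ereal b" "0 \<le> b"
  shows "(\<integral>\<^sup>+x. e2ennreal (ereal b - f x) \<partial>M) + expect_pos M f = ennreal b + expect_neg M f"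
    "expect_pos M f \<le> ennreal b"
proof -
  interpret prob_space M by fact
  have "(\<integral>\<^sup>+x. e2ennreal (ereal b - f x) \<partial>M) + expect_pos M f
      = (\<integral>\<^sup>+x. e2ennreal (ereal b - f x) + e2ennreal (f x) \<partial>M)"
    unfolding expect_pos_def using f by (subst nn_integral_add) auto
  also have "\<dots> = (\<integral>\<^sup>+x. ennreal b + e2ennreal (- f x) \<partial>M)"
    using b by (intro nn_integral_cong e2ennreal_shift)
  also have "\<dots> = ennreal b + expect_neg M f"
    unfolding expect_neg_def using f by (subst nn_integral_add) (auto simp: emeasure_space_1)
  finally show "(\<integral>\<^sup>+x. e2ennreal (ereal b - f x) \<partial>M) + expect_pos M f = ennreal b + expect_neg M f" .
  have "expect_pos M f \<le> (\<integral>\<^sup>+x. ennreal b \<partial>M)"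
    unfolding expect_pos_def
    by (intro nn_integral_mono) (use e2ennreal_mono[OF b(1)] in \<open>simp add: e2ennreal_ereal\<close>)
  then show "expect_pos M f \<le> ennreal b" by (simp add: emeasure_space_1)
qed

text \<open>\<open>G\<close> is left abstract so that one statement serves both the integral for a
  single act and the weighted sum for a finite mixture of acts.\<close>

lemma expect_eq_minus:
  assumes "G + expect_pos M f = ennreal b + expect_neg M f" "expect_pos M f \<le> ennreal b" "0 \<le> b"
  shows "expect M f = ereal b - enn2ereal G"
proof -
  obtain p where p: "expect_pos M f = ennreal p" "0 \<le> p"
    using assms(2) by (cases "expect_pos M f") (auto simp: top_unique)
  show ?thesis
  proof (cases "expect_neg M f")
    case (real n)
    then have ne: "ennreal b + expect_neg M f \<noteq> top" by (simp add: ennreal_add_eq_top)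
    have "G \<noteq> top"
    proof
      assume "G = top"
      then have "G + expect_pos M f = top" by simp
      with assms(1) ne show False by metis
    qed
    then obtain g where g: "G = ennreal g" "0 \<le> g" by (cases G) auto
    then have "ennreal (g + p) = ennreal (b + n)" using assms p real by simp
    then have "g + p = b + n" using g p real assms(3) by (subst (asm) ennreal_inj) auto
    then show ?thesis using p real g by (simp add: expect_def)
  next
    case top
    then have "G = top" using assms(1) p by (auto simp: ennreal_add_eq_top)
    then show ?thesis using p top by (simp add: expect_def)
  qed
qed

text \<open>A point measure carries the power set of \<open>S\<close> as its sigma-field; the
  pushforward under the identity moves it to the sigma-field of \<open>A\<close>.\<close>

definition finite_act :: "'a measure \<Rightarrow> 'a set \<Rightarrow> ('a \<Rightarrow> real) \<Rightarrow> 'a measure" where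
  "finite_act A S w = distr (point_measure S (\<lambda>a. ennreal (w a))) A (\<lambda>a. a)"

lemma sets_finite_act [measurable_cong, simp]: "sets (finite_act A S w) = sets A"
  by (simp add: finite_act_def)

lemma nn_integral_finite_act:
  assumes "finite S" "S \<subseteq> space A" "h \<in> borel_measurable A"
  shows "(\<integral>\<^sup>+a. h a \<partial>finite_act A S w) = (\<Sum>a\<in>S. ennreal (w a) * h a)"
  using assms unfolding finite_act_def
  by (subst nn_integral_distr) (auto simp: measurable_point_measure_eq1 nn_integral_point_measure_finite)

lemma prob_space_finite_act:
  assumes "finite S" "S \<subseteq> space A" "\<And>a. a \<in> S \<Longrightarrow> 0 \<le> w a" "(\<Sum>a\<in>S. w a) = 1"
  shows "prob_space (finite_act A S w)"
proof
  have "emeasure (finite_act A S w) (space (finite_act A S w)) = (\<integral>\<^sup>+a. 1 \<partial>finite_act A S w)" by simp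
  also have "\<dots> = (\<Sum>a\<in>S. ennreal (w a))" using assms by (subst nn_integral_finite_act) auto
  also have "\<dots> = 1" using assms by simp
  finally show "emeasure (finite_act A S w) (space (finite_act A S w)) = 1" .
qed

lemma nn_integral_pair_finite_act:
  assumes "prob_space P" "prob_space (finite_act A S w)" "finite S" "S \<subseteq> space A"
    and h: "h \<in> borel_measurable (P \<Otimes>\<^sub>M A)"
  shows "(\<integral>\<^sup>+z. h z \<partial>(P \<Otimes>\<^sub>M finite_act A S w)) = (\<Sum>a\<in>S. ennreal (w a) * (\<integral>\<^sup>+x. h (x, a) \<partial>P))"
proof -
  interpret P: prob_space P by fact
  interpret Z: prob_space "finite_act A S w" by fact
  interpret pair_sigma_finite P "finite_act A S w" ..
  have h': "h \<in> borel_measurable (P \<Otimes>\<^sub>M finite_act A S w)"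
    using h by (simp cong: measurable_cong_sets)
  have "(\<lambda>a. \<integral>\<^sup>+x. h (x, a) \<partial>P) \<in> borel_measurable A"
    using h by (measurable)
  then show ?thesis
    unfolding nn_integral_snd[OF h', symmetric] using assms by (simp add: nn_integral_finite_act)
qed

subsection \<open>Games with upper semicontinuous loss\<close>

locale usc_game =
  fixes A :: "'a measure" and L :: "'x::metric_space \<Rightarrow> 'a \<Rightarrow> ereal"
  assumes game: "basic_game borel A L"
    and bounded_above: "a \<in> space A \<Longrightarrow> \<exists>b::real. \<forall>x. L x a \<le> ereal b"
    and usc: "a \<in> space A \<Longrightarrow> upper_semicontinuous (\<lambda>x. L x a)"
begin

lemma acts_nonempty: "space A \<noteq> {}"
  using game by (simp add: basic_game_def)

lemma loss_measurable: "(\<lambda>(x, a). L x a) \<in> borel_measurable (borel \<Otimes>\<^sub>M A)"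
  using game by (simp add: basic_game_def)

lemma section_measurable:
  assumes "a \<in> space A" "sets P = sets borel" shows "(\<lambda>x. L x a) \<in> borel_measurable P"
proof -
  have "(\<lambda>x. L x a) \<in> borel_measurable borel"
    using measurable_Pair2'[of a A] measurable_compose[OF _ loss_measurable, of "\<lambda>x. (x, a)" borel] assms(1)
    by simp
  then show ?thesis using assms(2) by (simp cong: measurable_cong_sets)
qed

lemma distsD:
  assumes "P \<in> dists borel A L" shows "prob_space P" "sets P = sets borel"
  using assms prob_algebraD[of P borel] by (auto simp: dists_def)

text \<open>The level \<open>c\<close> lets a caller keep the bound above a prescribed real, so that
  a difference such as \<open>b - e\<close> is nonnegative.\<close>

lemma finite_upper_bound:
  assumes "finite S" "S \<subseteq> space A"
  shows "\<exists>b\<ge>c. 0 \<le> b \<and> (\<forall>a\<in>S. \<forall>x. L x a \<le> ereal b)"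
  using assms
proof (induction S rule: finite_induct)
  case empty
  show ?case by (rule exI[of _ "max c 0"]) simp
next
  case (insert a S)
  then obtain b b' where b: "c \<le> b" "0 \<le> b" "\<forall>a\<in>S. \<forall>x. L x a \<le> ereal b" "\<forall>x. L x a \<le> ereal b'"
    using bounded_above[of a] by auto
  have "ereal b \<le> ereal (max b b')" "ereal b' \<le> ereal (max b b')" by (simp_all only: ereal_less_eq)
  then have "\<forall>a\<in>insert a S. \<forall>x. L x a \<le> ereal (max b b')"
    using b(3,4) by (metis insert_iff order_trans)
  then show ?case using b(1,2) by (intro exI[of _ "max b b'"]) auto
qed

lemma upper_bound:
  assumes "a \<in> space A" shows "\<exists>b\<ge>0. \<forall>x. L x a \<le> ereal b"
  using finite_upper_bound[of "{a}" 0] assms by auto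

lemma loss_eq_minus:
  assumes "a \<in> space A" "prob_space P" "sets P = sets borel" "\<And>x. L x a \<le> ereal b" "0 \<le> b"
  shows "loss L P a = ereal b - enn2ereal (\<integral>\<^sup>+x. e2ennreal (ereal b - L x a) \<partial>P)"
  unfolding loss_def
  by (intro expect_eq_minus expect_pos_neg_shift section_measurable assms)

text \<open>Averaging the shift identities and the bounds on positive parts over \<open>S\<close>
  gives the same facts for the product measure. A positive part of at most \<open>b\<close> leaves
  the expectation defined for every admissible \<open>P\<close>, whence membership in
  \<open>rand_acts\<close>.\<close>

lemma finite_act_loss:
  assumes S: "finite S" "S \<subseteq> space A" "\<And>a. a \<in> S \<Longrightarrow> 0 \<le> w a" "(\<Sum>a\<in>S. w a) = 1"
    and b: "\<And>a x. a \<in> S \<Longrightarrow> L x a \<le> ereal b" "0 \<le> b"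
  shows "finite_act A S w \<in> rand_acts borel A L"
    and "P \<in> dists borel A L \<Longrightarrow> rand_loss L P (finite_act A S w) =
      ereal b - enn2ereal (\<Sum>a\<in>S. ennreal (w a) * (\<integral>\<^sup>+x. e2ennreal (ereal b - L x a) \<partial>P))"
proof -
  let ?\<zeta> = "finite_act A S w"
  have \<zeta>: "prob_space ?\<zeta>" by (rule prob_space_finite_act[OF S])
  have eqs: "expect_pos (P \<Otimes>\<^sub>M ?\<zeta>) (\<lambda>(x, a). L x a) \<le> ennreal b \<and>
      (\<Sum>a\<in>S. ennreal (w a) * (\<integral>\<^sup>+x. e2ennreal (ereal b - L x a) \<partial>P))
        + expect_pos (P \<Otimes>\<^sub>M ?\<zeta>) (\<lambda>(x, a). L x a) = ennreal b + expect_neg (P \<Otimes>\<^sub>M ?\<zeta>) (\<lambda>(x, a). L x a)"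
    if P: "P \<in> dists borel A L" for P
  proof -
    have L: "(\<lambda>z. L (fst z) (snd z)) \<in> borel_measurable (P \<Otimes>\<^sub>M A)"
      using loss_measurable distsD(2)[OF P] by (simp add: case_prod_beta cong: measurable_cong_sets sets_pair_measure_cong)
    have pos: "expect_pos (P \<Otimes>\<^sub>M ?\<zeta>) (\<lambda>(x, a). L x a) = (\<Sum>a\<in>S. ennreal (w a) * expect_pos P (\<lambda>x. L x a))"
      unfolding expect_pos_def using L
      by (subst nn_integral_pair_finite_act[OF distsD(1)[OF P] \<zeta> S(1,2)]) (auto simp: case_prod_beta)
    have neg: "expect_neg (P \<Otimes>\<^sub>M ?\<zeta>) (\<lambda>(x, a). L x a) = (\<Sum>a\<in>S. ennreal (w a) * expect_neg P (\<lambda>x. L x a))"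
      unfolding expect_neg_def using L
      by (subst nn_integral_pair_finite_act[OF distsD(1)[OF P] \<zeta> S(1,2)]) (auto simp: case_prod_beta)
    have sum_w: "(\<Sum>a\<in>S. ennreal (w a) * ennreal b) = ennreal b"
      using S b by (simp add: sum_distrib_right[symmetric])
    have shift: "(\<integral>\<^sup>+x. e2ennreal (ereal b - L x a) \<partial>P) + expect_pos P (\<lambda>x. L x a)
        = ennreal b + expect_neg P (\<lambda>x. L x a)" "expect_pos P (\<lambda>x. L x a) \<le> ennreal b" if "a \<in> S" for a
      using expect_pos_neg_shift[OF distsD(1)[OF P] section_measurable, of a b] distsD(2)[OF P] that b S by auto
    have "(\<Sum>a\<in>S. ennreal (w a) * (\<integral>\<^sup>+x. e2ennreal (ereal b - L x a) \<partial>P))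
        + expect_pos (P \<Otimes>\<^sub>M ?\<zeta>) (\<lambda>(x, a). L x a)
      = (\<Sum>a\<in>S. ennreal (w a) * ((\<integral>\<^sup>+x. e2ennreal (ereal b - L x a) \<partial>P) + expect_pos P (\<lambda>x. L x a)))"
      unfolding pos by (simp add: sum.distrib[symmetric] distrib_left)
    also have "\<dots> = (\<Sum>a\<in>S. ennreal (w a) * (ennreal b + expect_neg P (\<lambda>x. L x a)))"
      by (intro sum.cong refl) (simp add: shift)
    also have "\<dots> = ennreal b + expect_neg (P \<Otimes>\<^sub>M ?\<zeta>) (\<lambda>(x, a). L x a)"
      unfolding neg by (simp add: distrib_left sum.distrib sum_w)
    finally have "(\<Sum>a\<in>S. ennreal (w a) * (\<integral>\<^sup>+x. e2ennreal (ereal b - L x a) \<partial>P))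
        + expect_pos (P \<Otimes>\<^sub>M ?\<zeta>) (\<lambda>(x, a). L x a) = ennreal b + expect_neg (P \<Otimes>\<^sub>M ?\<zeta>) (\<lambda>(x, a). L x a)" .
    moreover have "expect_pos (P \<Otimes>\<^sub>M ?\<zeta>) (\<lambda>(x, a). L x a) \<le> (\<Sum>a\<in>S. ennreal (w a) * ennreal b)"
      unfolding pos by (intro sum_mono mult_left_mono shift) auto
    ultimately show ?thesis by (simp add: sum_w)
  qed
  have "expect_defined (P \<Otimes>\<^sub>M ?\<zeta>) (\<lambda>(x, a). L x a)" if "P \<in> dists borel A L" for P
    using eqs[OF that] by (auto simp: expect_defined_def top_unique)
  then show "?\<zeta> \<in> rand_acts borel A L"
    using \<zeta> by (simp add: rand_acts_def space_prob_algebra)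
  show "rand_loss L P ?\<zeta> = ereal b - enn2ereal (\<Sum>a\<in>S. ennreal (w a) * (\<integral>\<^sup>+x. e2ennreal (ereal b - L x a) \<partial>P))"
    if "P \<in> dists borel A L"
    unfolding rand_loss_def using eqs[OF that] b by (intro expect_eq_minus) auto
qed

text \<open>Integrates \<open>H(P) \<le> L(P, a)\<close> over \<open>a\<close> by Tonelli. Since the
  losses may be infinite, positive and negative parts are integrated separately and subtracted only
  at the end.\<close>

lemma gen_entropy_le_rand_loss:
  assumes P: "P \<in> dists borel A L" and \<zeta>: "\<zeta> \<in> rand_acts borel A L"
  shows "gen_entropy A L P \<le> rand_loss L P \<zeta>"
proof (cases "gen_entropy A L P")
  case PInf
  obtain a where a: "a \<in> space A" using acts_nonempty by blast
  obtain b where b: "0 \<le> b" "\<And>x. L x a \<le> ereal b" using upper_bound[OF a] by blast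
  have "gen_entropy A L P \<le> loss L P a" unfolding gen_entropy_def using a by (rule INF_lower)
  also have "\<dots> \<le> ereal b" unfolding loss_eq_minus[OF a distsD[OF P] b(2,1)]
    by (cases "\<integral>\<^sup>+x. e2ennreal (ereal b - L x a) \<partial>P") auto
  finally show ?thesis using PInf by simp
next
  case (real h)
  interpret P: prob_space P by (rule distsD[OF P])
  have \<zeta>_prob: "prob_space \<zeta>" "sets \<zeta> = sets A"
    using \<zeta> prob_algebraD[of \<zeta> A] by (auto simp: rand_acts_def)
  interpret Z: prob_space \<zeta> by fact
  interpret pair_sigma_finite P \<zeta> ..
  have L: "(\<lambda>z. L (fst z) (snd z)) \<in> borel_measurable (P \<Otimes>\<^sub>M \<zeta>)"
    using loss_measurable distsD(2)[OF P] \<zeta>_prob(2)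
    by (simp add: case_prod_beta cong: measurable_cong_sets sets_pair_measure_cong)
  define p n where "p a = expect_pos P (\<lambda>x. L x a)" and "n a = expect_neg P (\<lambda>x. L x a)" for a
  have E: "expect_pos (P \<Otimes>\<^sub>M \<zeta>) (\<lambda>(x, a). L x a) = (\<integral>\<^sup>+a. p a \<partial>\<zeta>)"
    "expect_neg (P \<Otimes>\<^sub>M \<zeta>) (\<lambda>(x, a). L x a) = (\<integral>\<^sup>+a. n a \<partial>\<zeta>)"
    unfolding expect_pos_def expect_neg_def p_def n_def using L
    by (simp_all add: nn_integral_snd[symmetric] case_prod_beta)
  have [measurable]: "(\<lambda>z. L (snd z) (fst z)) \<in> borel_measurable (\<zeta> \<Otimes>\<^sub>M P)"
    using measurable_pair_swap[OF L] by (simp add: case_prod_beta)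
  have meas: "p \<in> borel_measurable \<zeta>" "n \<in> borel_measurable \<zeta>"
    unfolding p_def[abs_def] n_def[abs_def] expect_pos_def expect_neg_def by measurable
  \<comment> \<open>\<open>ennreal\<close> sends negative reals to 0, so \<open>ennreal h\<close>
    and \<open>ennreal (- h)\<close> are the two parts of \<open>h\<close>, and the inequality
    expresses \<open>h \<le> p a - n a\<close> without subtraction.\<close>
  have pointwise: "n a + ennreal h \<le> p a + ennreal (- h)" if "a \<in> space \<zeta>" for a
  proof -
    have a: "a \<in> space A" using that sets_eq_imp_space_eq[OF \<zeta>_prob(2)] by simp
    obtain b where b: "0 \<le> b" "\<And>x. L x a \<le> ereal b" using upper_bound[OF a] by blast
    have "p a \<le> ennreal b"
      unfolding p_def by (rule expect_pos_neg_shift(2)[OF distsD(1)[OF P] section_measurable[OF a distsD(2)[OF P]] b(2,1)])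
    then obtain r where r: "p a = ennreal r" "0 \<le> r" by (cases "p a") (auto simp: top_unique)
    have "gen_entropy A L P \<le> loss L P a" unfolding gen_entropy_def using a by (rule INF_lower)
    then have le: "ereal h \<le> enn2ereal (p a) - enn2ereal (n a)"
      by (simp add: real loss_def expect_def p_def n_def)
    then obtain s where s: "n a = ennreal s" "0 \<le> s" using r by (cases "n a") auto
    have "h \<le> r - s" using le r s by simp
    then have "ennreal (s + max h 0) \<le> ennreal (r + max (- h) 0)" by (intro ennreal_leI) auto
    then show ?thesis using r s by (simp add: ennreal_max_0 ennreal_max_0')
  qed
  have "(\<integral>\<^sup>+a. n a + ennreal h \<partial>\<zeta>) \<le> (\<integral>\<^sup>+a. p a + ennreal (- h) \<partial>\<zeta>)"
    by (rule nn_integral_mono[OF pointwise])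
  then have le: "(\<integral>\<^sup>+a. n a \<partial>\<zeta>) + ennreal h \<le> (\<integral>\<^sup>+a. p a \<partial>\<zeta>) + ennreal (- h)"
    using meas by (simp add: nn_integral_add Z.emeasure_space_1)
  \<comment> \<open>Membership of \<zeta> in \<open>rand_acts\<close> excludes the form \<infinity>
    - \<infinity> here.\<close>
  have defined: "\<not> ((\<integral>\<^sup>+a. p a \<partial>\<zeta>) = top \<and> (\<integral>\<^sup>+a. n a \<partial>\<zeta>) = top)"
    using \<zeta> P by (auto simp: rand_acts_def expect_defined_def E)
  have "ereal h \<le> enn2ereal p' - enn2ereal n'" if le: "n' + ennreal h \<le> p' + ennreal (- h)" and "\<not> (p' = top \<and> n' = top)" for p' n'
  proof (cases p')
    case top
    then show ?thesis using that by (cases n') auto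
  next
    case (real r)
    then have "n' \<noteq> top" using le by (auto simp: top_unique ennreal_add_eq_top)
    then obtain s where s: "n' = ennreal s" "0 \<le> s" by (cases n') auto
    have "ennreal (s + max h 0) \<le> ennreal (r + max (- h) 0)"
      using le real s by (simp add: ennreal_max_0 ennreal_max_0')
    then have "s + max h 0 \<le> r + max (- h) 0" using real by (subst (asm) ennreal_le_iff) auto
    then show ?thesis using real s by simp
  qed
  from this[OF le defined] show ?thesis
    unfolding rand_loss_def expect_def E real .
qed simp

text \<open>The loss is a constant minus the integral of a supremum of bounded continuous functions.\<close>

lemma closed_superlevel_loss:
  assumes a: "a \<in> space A"
  obtains B :: "(('x \<Rightarrow>\<^sub>C real) \<Rightarrow> real) set" where "closed B"
    "\<And>P. prob_space P \<Longrightarrow> sets P = sets borel \<Longrightarrow>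
      (\<lambda>f. \<integral>x. apply_bcontfun f x \<partial>P) \<in> B \<longleftrightarrow> ereal c \<le> loss L P a"
proof -
  obtain b where b: "0 \<le> b" "\<And>x. L x a \<le> ereal b" using upper_bound[OF a] by blast
  define g where "g x = e2ennreal (ereal b - L x a)" for x
  have enn_g: "enn2ereal (g x) = ereal b - L x a" for x
    unfolding g_def using b(2)[of x] by (intro enn2ereal_e2ennreal) (cases "L x a"; simp)
  have lsc: "eventually (\<lambda>y. r < g y) (at x)" if "r < g x" for x r
  proof -
    have less_iff: "r < g y \<longleftrightarrow> L y a < ereal b - enn2ereal r" for y
    proof -
      obtain s where s: "r = ennreal s" "0 \<le> s" using \<open>r < g x\<close> by (cases r) auto
      show ?thesis
        unfolding less_ennreal.rep_eq enn_g s by (cases "L y a") (use s in auto)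
    qed
    have "Limsup (at x) (\<lambda>y. L y a) < ereal b - enn2ereal r"
      using usc[OF a] that unfolding upper_semicontinuous_def less_iff by (meson order_le_less_trans)
    from Limsup_lessD[OF this] show ?thesis by (simp add: less_iff)
  qed
  obtain u where u: "\<And>n. u n \<in> bcontfun" "\<And>n x. 0 \<le> u n x"
    "\<And>x. incseq (\<lambda>n. u n x)" "\<And>x. (SUP n. ennreal (u n x)) = g x"
    using lsc_eq_SUP_bcontfun[OF lsc] by blast
  \<comment> \<open>Each condition concerns one coordinate. Together they say that the integral of
    \<open>g\<close> is at most \<open>b - c\<close>, which amounts to
    \<open>L(P, a) \<ge> c\<close>.\<close>
  define B :: "(('x \<Rightarrow>\<^sub>C real) \<Rightarrow> real) set" where "B = (\<Inter>n. {\<Lambda>. \<Lambda> (Bcontfun (u n)) \<le> b - c})"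
  show thesis
  proof (rule that[of B])
    show "closed B"
      unfolding B_def
      by (intro closed_INT ballI closed_Collect_le continuous_on_const continuous_on_product_coordinates)
    fix P :: "'x measure" assume P: "prob_space P" "sets P = sets borel"
    have int: "integrable P (u n)" for n
      by (rule integrable_bcontfun[OF u(1) prob_space.finite_measure[OF P(1)] P(2)])
    have "(\<integral>\<^sup>+x. g x \<partial>P) = (SUP n. \<integral>\<^sup>+x. ennreal (u n x) \<partial>P)"
      unfolding u(4)[symmetric]
      using u(3) int by (intro nn_integral_monotone_convergence_SUP)
        (auto simp: mono_def le_fun_def intro!: ennreal_leI)
    also have "\<dots> = (SUP n. ennreal (\<integral>x. u n x \<partial>P))"
      using int u(2) by (simp add: nn_integral_eq_integral)
    finally have G: "(\<integral>\<^sup>+x. g x \<partial>P) = (SUP n. ennreal (\<integral>x. u n x \<partial>P))" .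
    have nonneg: "0 \<le> (\<integral>x. u n x \<partial>P)" for n using u(2) by (simp add: integral_nonneg)
    have "ereal c \<le> loss L P a \<longleftrightarrow> enn2ereal (\<integral>\<^sup>+x. g x \<partial>P) \<le> ereal (b - c)"
      unfolding loss_eq_minus[OF a P b(2,1)] g_def[symmetric]
      by (cases "\<integral>\<^sup>+x. g x \<partial>P") auto
    also have "\<dots> \<longleftrightarrow> (\<forall>n. (\<integral>x. u n x \<partial>P) \<le> b - c)"
    proof (cases "0 \<le> b - c")
      case True
      then have "enn2ereal (\<integral>\<^sup>+x. g x \<partial>P) \<le> ereal (b - c) \<longleftrightarrow> (\<integral>\<^sup>+x. g x \<partial>P) \<le> ennreal (b - c)"
        by (simp add: less_eq_ennreal.rep_eq)
      then show ?thesis unfolding G using True by (simp add: SUP_le_iff ennreal_le_iff)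
    next
      \<comment> \<open>\<open>ennreal\<close> would replace the negative level by 0, so this case
        is separate: both sides fail, since the integrals are nonnegative.\<close>
      case False
      then have "\<not> enn2ereal (\<integral>\<^sup>+x. g x \<partial>P) \<le> ereal (b - c)"
        using enn2ereal_nonneg[of "\<integral>\<^sup>+x. g x \<partial>P"] by (metis ereal_less_eq(5) order_trans)
      then show ?thesis using False nonneg[of 0] by (meson order_trans)
    qed
    finally show "(\<lambda>f. \<integral>x. apply_bcontfun f x \<partial>P) \<in> B \<longleftrightarrow> ereal c \<le> loss L P a"
      using u(1) by (simp add: B_def)
  qed
qed

text \<open>Subtracting the losses from a common bound \<open>b\<close> yields nonnegative affine
  functions \<open>N a\<close>, and a small minimum of losses becomes a large maximum of the
  \<open>N a\<close>. The weights from \<open>finite_minimax\<close> define the randomized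
  act.\<close>

lemma finite_game_minimax:
  assumes \<Gamma>: "\<Gamma> \<subseteq> dists borel A L" "convex_dists \<Gamma>"
    and S: "finite S" "S \<noteq> {}" "S \<subseteq> space A"
    and less: "\<And>P. P \<in> \<Gamma> \<Longrightarrow> \<exists>a\<in>S. loss L P a \<le> ereal c" and "c < e"
  shows "\<exists>\<zeta>\<in>rand_acts borel A L. \<forall>P\<in>\<Gamma>. rand_loss L P \<zeta> \<le> ereal e"
proof -
  obtain b where b: "0 \<le> b" "e \<le> b" "\<And>a x. a \<in> S \<Longrightarrow> L x a \<le> ereal b"
    using finite_upper_bound[OF S(1,3)] by blast
  define N where "N a P = (\<integral>\<^sup>+x. e2ennreal (ereal b - L x a) \<partial>P)" for a P
  have meas: "(\<lambda>x. e2ennreal (ereal b - L x a)) \<in> borel_measurable P" if "a \<in> S" "P \<in> \<Gamma>" for a P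
  proof -
    have [measurable]: "(\<lambda>x. L x a) \<in> borel_measurable P"
      using section_measurable[of a P] distsD(2)[of P] that S \<Gamma> by auto
    show ?thesis by measurable
  qed
  have "\<exists>w. (\<forall>a\<in>S. 0 \<le> w a) \<and> (\<Sum>a\<in>S. w a) = 1 \<and>
      (\<forall>P\<in>\<Gamma>. (\<Sum>a\<in>S. ennreal (w a) * N a P) \<ge> ennreal (b - e))"
  proof (rule finite_minimax[OF S(1,2), where mix = mixture and d = "b - c"])
    fix t :: real and P Q assume t: "t \<in> {0..1}" and P: "P \<in> \<Gamma>" and Q: "Q \<in> \<Gamma>"
    show "mixture t P Q \<in> \<Gamma>" using \<Gamma>(2) t P Q by (simp add: convex_dists_def)
  next
    fix a and t :: real and P Q assume a: "a \<in> S" and P: "P \<in> \<Gamma>" and Q: "Q \<in> \<Gamma>"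
    show "N a (mixture t P Q) = ennreal t * N a P + ennreal (1 - t) * N a Q"
      unfolding N_def using distsD(2) P Q \<Gamma>(1) meas[OF a P] by (intro nn_integral_mixture) (auto simp: subset_iff)
  next
    show "0 \<le> b - e" "b - e < b - c" using b \<open>c < e\<close> by auto
    fix P assume P: "P \<in> \<Gamma>"
    then obtain a where a: "a \<in> S" "loss L P a \<le> ereal c" using less by blast
    have "loss L P a = ereal b - enn2ereal (N a P)"
      unfolding N_def using a P S \<Gamma> b distsD[of P] by (intro loss_eq_minus) auto
    then have "ennreal (b - c) \<le> N a P"
      using a(2) by (cases "N a P") (auto intro: ennreal_leI)
    then show "\<exists>a\<in>S. ennreal (b - c) \<le> N a P" using a(1) by blast
  qed
  then obtain w where w: "\<And>a. a \<in> S \<Longrightarrow> 0 \<le> w a" "(\<Sum>a\<in>S. w a) = 1"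
    "\<And>P. P \<in> \<Gamma> \<Longrightarrow> (\<Sum>a\<in>S. ennreal (w a) * N a P) \<ge> ennreal (b - e)" by blast
  show ?thesis
  proof (intro bexI[of _ "finite_act A S w"] ballI)
    show "finite_act A S w \<in> rand_acts borel A L"
      by (rule finite_act_loss(1)[OF S(1,3) w(1,2) b(3,1)])
    fix P assume P: "P \<in> \<Gamma>"
    then have "rand_loss L P (finite_act A S w) = ereal b - enn2ereal (\<Sum>a\<in>S. ennreal (w a) * N a P)"
      unfolding N_def using \<Gamma> by (intro finite_act_loss(2)[OF S(1,3) w(1,2) b(3,1)]) auto
    also have "\<dots> \<le> ereal e"
      using w(3)[OF P] b by (cases "\<Sum>a\<in>S. ennreal (w a) * N a P") (auto simp: ennreal_le_iff)
    finally show "rand_loss L P (finite_act A S w) \<le> ereal e" .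
  qed
qed

text \<open>A single act, played with probability one, already keeps the loss below its own upper
  bound.\<close>

lemma upper_value_less_top:
  assumes "\<Gamma> \<subseteq> dists borel A L"
  shows "upper_value borel A L \<Gamma> < \<infinity>"
proof -
  obtain a where a: "a \<in> space A" using acts_nonempty by blast
  obtain b where b: "0 \<le> b" "\<And>x. L x a \<le> ereal b" using upper_bound[OF a] by blast
  let ?\<zeta> = "finite_act A {a} (\<lambda>_. 1)"
  have \<zeta>: "?\<zeta> \<in> rand_acts borel A L" by (rule finite_act_loss(1)[of _ _ b]) (use a b in auto)
  have "rand_loss L P ?\<zeta> \<le> ereal b" if "P \<in> \<Gamma>" for P
  proof -
    have "rand_loss L P ?\<zeta> = ereal b - enn2ereal (\<Sum>a\<in>{a}. ennreal 1 * (\<integral>\<^sup>+x. e2ennreal (ereal b - L x a) \<partial>P))"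
      by (rule finite_act_loss(2)) (use a b that assms in auto)
    also have "\<dots> \<le> ereal b" by (cases "\<integral>\<^sup>+x. e2ennreal (ereal b - L x a) \<partial>P") auto
    finally show ?thesis .
  qed
  then have "upper_value borel A L \<Gamma> \<le> ereal b"
    unfolding upper_value_def by (intro INF_lower2[OF \<zeta>] SUP_least)
  then show ?thesis by (auto intro: le_less_trans)
qed

end

text \<open>The common value can be -\<infinity>, as the one-point game described with
  \<open>has_value\<close> shows. Hence \<open>has_value\<close> is asserted when some distribution
  in \<Gamma> has entropy other than -\<infinity>; equality of the values, the bound below
  \<infinity> and the maximiser are asserted outright.\<close>

theorem theorem6p1:
  fixes A :: "'a measure"
    and L :: "'x::metric_space \<Rightarrow> 'a \<Rightarrow> ereal"
    and \<Gamma> :: "'x measure set"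
  assumes game: "basic_game borel A L"
    and Gamma_dists: "\<Gamma> \<subseteq> dists borel A L"
    and Gamma_nonempty: "\<Gamma> \<noteq> {}"
    and Gamma_convex: "convex_dists \<Gamma>"
    and Gamma_closed: "closedin weak_topology \<Gamma>"
    and Gamma_tight: "tight_dists \<Gamma>"
    and bounded_above: "\<And>a. a \<in> space A \<Longrightarrow> \<exists>b::real. \<forall>x. L x a \<le> ereal b"
    and usc: "\<And>a. a \<in> space A \<Longrightarrow> upper_semicontinuous (\<lambda>x. L x a)"
  shows "lower_value borel A L \<Gamma> = upper_value borel A L \<Gamma> \<and>
         upper_value borel A L \<Gamma> < \<infinity> \<and>
         ((\<exists>P\<in>\<Gamma>. gen_entropy A L P \<noteq> -\<infinity>) \<longrightarrow> has_value borel A L \<Gamma>) \<and>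
         (\<exists>P. max_entropy_dist A L \<Gamma> P)"
proof -
  interpret usc_game A L by unfold_locales fact+
  let ?U = "upper_value borel A L \<Gamma>" and ?V = "lower_value borel A L \<Gamma>"
  define \<Phi> where "\<Phi> = (\<lambda>P (f :: 'x \<Rightarrow>\<^sub>C real). \<integral>x. apply_bcontfun f x \<partial>P)"
  have dists: "P \<in> dists borel A L" if "P \<in> \<Gamma>" for P using Gamma_dists that by blast
  have "?V \<le> ?U"
    unfolding lower_value_def upper_value_def
  proof (intro SUP_least INF_greatest)
    fix P \<zeta> assume P: "P \<in> \<Gamma>" and \<zeta>: "\<zeta> \<in> rand_acts borel A L"
    have "(INF \<zeta>\<in>rand_acts borel A L. rand_loss L P \<zeta>) \<le> rand_loss L P \<zeta>" by (rule INF_lower[OF \<zeta>])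
    also have "\<dots> \<le> (SUP P\<in>\<Gamma>. rand_loss L P \<zeta>)" by (rule SUP_upper[OF P])
    finally show "(INF \<zeta>\<in>rand_acts borel A L. rand_loss L P \<zeta>) \<le> (SUP P\<in>\<Gamma>. rand_loss L P \<zeta>)" .
  qed
  have entropy_le: "gen_entropy A L P \<le> ?V" if "P \<in> \<Gamma>" for P
    unfolding lower_value_def
    by (intro SUP_upper2[OF that] INF_greatest gen_entropy_le_rand_loss dists that)
  \<comment> \<open>Only real levels strictly below \<open>?U\<close> enter, which leaves room for
    the slack in \<open>finite_game_minimax\<close>. If \<open>?U\<close> is -\<infinity>, then
    \<open>I\<close> is empty.\<close>
  define I where "I = {(a, c). a \<in> space A \<and> ereal c < ?U}"
  have "\<forall>i\<in>I. \<exists>B. closed B \<and> (\<forall>P\<in>\<Gamma>. \<Phi> P \<in> B \<longleftrightarrow> ereal (snd i) \<le> loss L P (fst i))"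
  proof
    fix i assume "i \<in> I"
    then have a: "fst i \<in> space A" by (auto simp: I_def)
    show "\<exists>B. closed B \<and> (\<forall>P\<in>\<Gamma>. \<Phi> P \<in> B \<longleftrightarrow> ereal (snd i) \<le> loss L P (fst i))"
      using closed_superlevel_loss[OF a, of "snd i"] distsD dists unfolding \<Phi>_def by metis
  qed
  then obtain B where B: "\<And>i. i \<in> I \<Longrightarrow> closed (B i)"
    "\<And>i P. i \<in> I \<Longrightarrow> P \<in> \<Gamma> \<Longrightarrow> \<Phi> P \<in> B i \<longleftrightarrow> ereal (snd i) \<le> loss L P (fst i)" by metis
  have "\<Phi> ` \<Gamma> \<inter> (\<Inter>i\<in>I. B i) \<noteq> {}"
  proof (rule compact_imp_fip_image)
    show "compact (\<Phi> ` \<Gamma>)"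
      unfolding \<Phi>_def using Gamma_dists by (intro compact_expectations Gamma_closed Gamma_tight) (auto simp: dists_def)
    show "closed (B i)" if "i \<in> I" for i by (rule B(1)[OF that])
    fix J assume J: "finite J" "J \<subseteq> I"
    show "\<Phi> ` \<Gamma> \<inter> (\<Inter>i\<in>J. B i) \<noteq> {}"
    proof
      assume "\<Phi> ` \<Gamma> \<inter> (\<Inter>i\<in>J. B i) = {}"
      have ex: "\<exists>i\<in>J. loss L P (fst i) < ereal (snd i)" if "P \<in> \<Gamma>" for P
      proof (rule ccontr)
        assume "\<not> ?thesis"
        then have "\<Phi> P \<in> B i" if "i \<in> J" for i
          using B(2)[of i P] J(2) \<open>P \<in> \<Gamma>\<close> that by (force simp: not_less)
        then show False using \<open>P \<in> \<Gamma>\<close> \<open>\<Phi> ` \<Gamma> \<inter> (\<Inter>i\<in>J. B i) = {}\<close> by blast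
      qed
      then have "J \<noteq> {}" using Gamma_nonempty by blast
      \<comment> \<open>Every \<open>P\<close> has a loss below one of the levels in
        \<open>J\<close>, hence below the largest of them. Being attained, that maximum is still
        below \<open>?U\<close>.\<close>
      define c where "c = Max (snd ` J)"
      have le_c: "snd i \<le> c" if "i \<in> J" for i using that J(1) by (auto simp: c_def)
      have "c \<in> snd ` J" unfolding c_def using J(1) \<open>J \<noteq> {}\<close> by (intro Max_in) auto
      then have "ereal c < ?U" using J(2) by (auto simp: I_def)
      then obtain e where e: "c < e" "ereal e < ?U" using ereal_dense2[of "ereal c" ?U] by auto
      have "\<exists>\<zeta>\<in>rand_acts borel A L. \<forall>P\<in>\<Gamma>. rand_loss L P \<zeta> \<le> ereal e"
      proof (rule finite_game_minimax[OF Gamma_dists Gamma_convex, of "fst ` J" c e])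
        fix P assume "P \<in> \<Gamma>"
        then obtain i where i: "i \<in> J" "loss L P (fst i) < ereal (snd i)" using ex by blast
        have "ereal (snd i) \<le> ereal c" using le_c[OF i(1)] by simp
        then have "loss L P (fst i) \<le> ereal c" using i(2) by (meson less_imp_le order_trans)
        then show "\<exists>a\<in>fst ` J. loss L P a \<le> ereal c" using i(1) by blast
      qed (use J \<open>J \<noteq> {}\<close> e(1) in \<open>auto simp: I_def\<close>)
      then obtain \<zeta> where \<zeta>: "\<zeta> \<in> rand_acts borel A L" "\<And>P. P \<in> \<Gamma> \<Longrightarrow> rand_loss L P \<zeta> \<le> ereal e"
        by blast
      have "?U \<le> ereal e"
        unfolding upper_value_def by (intro INF_lower2[OF \<zeta>(1)] SUP_least \<zeta>(2))
      then show False using e(2) by simp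
    qed
  qed
  then obtain P where P: "P \<in> \<Gamma>" "\<And>i. i \<in> I \<Longrightarrow> \<Phi> P \<in> B i" by auto
  have "?U \<le> gen_entropy A L P"
    unfolding gen_entropy_def
  proof (rule INF_greatest)
    fix a assume a: "a \<in> space A"
    show "?U \<le> loss L P a"
    proof (rule ccontr)
      assume "\<not> ?U \<le> loss L P a"
      then have "loss L P a < ?U" by simp
      then obtain c where c: "loss L P a < ereal c" "ereal c < ?U"
        using ereal_dense2 by blast
      then have "(a, c) \<in> I" using a by (simp add: I_def)
      then have "ereal c \<le> loss L P a" using B(2)[OF _ P(1), of "(a, c)"] P(2) by simp
      then show False using c(1) by simp
    qed
  qed
  \<comment> \<open>This closes the circle \<open>?U \<le> H(P) \<le> ?V \<le> ?U\<close>.\<close>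
  then have eq: "gen_entropy A L P = ?U" "?V = ?U"
    using entropy_le[OF P(1)] \<open>?V \<le> ?U\<close> by auto
  have finite: "?U < \<infinity>" by (rule upper_value_less_top[OF Gamma_dists])
  have "has_value borel A L \<Gamma>" if ex: "\<exists>Q\<in>\<Gamma>. gen_entropy A L Q \<noteq> - \<infinity>"
  proof -
    obtain Q where "Q \<in> \<Gamma>" "gen_entropy A L Q \<noteq> - \<infinity>" using ex by blast
    then have "?U \<noteq> - \<infinity>" using entropy_le[of Q] eq(2) by auto
    then show ?thesis using eq(2) finite by (auto simp: has_value_def)
  qed
  moreover have "(SUP Q\<in>\<Gamma>. gen_entropy A L Q) = gen_entropy A L P"
    using entropy_le eq P(1) by (intro antisym SUP_least SUP_upper) auto
  then have "max_entropy_dist A L \<Gamma> P"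
    using P(1) by (simp add: max_entropy_dist_def)
  ultimately show ?thesis using eq(2) finite by blast
qed

end
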